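(* Let $G=(V,E)$ be a finite weighted graph with $|V|=n$ and symmetric real, possibly negative, weights $w_{uv}$ (nonzero only on $E$), and let $H=L+W$ be an $n\times n$ real symmetric matrix with eigenvalues $\lambda_0\le\lambda_1\le\dots\le\lambda_{n-1}$ and corresponding ground-state $\phi\ge 0$, where $L$ is the combinatorial Laplacian of $G$ and $W$ is a real diagonal matrix. Suppose that $G^+$ is connected and that admissible routings $\alpha$ exist. If $G^+$ has degree at most $d_{\max}$, then $$\lambda_1-\lambda_0\ \ge\ (d_{\max}+\rho)-\sqrt{(d_{\max}+\rho)^2-h^2},$$ where $\rho=\lambda_{n-1}-\lambda_0$ and $$h=\sup_{\alpha\ \text{admissible}}h_\alpha,\qquad h_\alpha=\min_{\emptyset\ne S\subsetneq V}\ \max_{S'\in\{S,\overline S\}}\frac{\sum_{\{u,v\}\in\partial S}\omega_{uv}(\alpha)}{\sum_{u\in S'}\phi^2(u)} .$$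
   Context: $L(u,u)=d_u=\sum_v w_{uv}$ and $L(u,v)=-w_{uv}$ for $u\neq v$. $E^+=\{\{u,v\}\in E: w_{uv}>0\}$, $E^-=\{\{u,v\}\in E:w_{uv}<0\}$, and $G^+=(V,E^+)$; its degrees are $\sum_{v:\{u,v\}\in E^+}w_{uv}$. $P(x,y)$ is the set of paths from $x$ to $y$ in $G^+$; $\ell_p$ is the length (number of edges) of a path $p$. A routing is a function $\alpha$ assigning to each path $p\in\bigcup_{\{x,y\}\in E}P(x,y)$ a weight $\alpha_p\in[0,1]$, $\alpha_p>0$, with $\sum_{p\in P(x,y)}\alpha_p=1$ for every edge $\{x,y\}\in E$. For $\{u,v\}\in E^+$ put $$\omega_{uv}(\alpha)=w_{uv}\phi(u)\phi(v)-\sum_{\{x,y\}:\,w_{xy}<0}\ \sum_{p\in P(x,y),\ \{u,v\}\in p}|w_{xy}|\,\ell_p\,\alpha_p\,\phi(x)\phi(y).$$ A routing $\alpha$ is called admissible if $\omega_{uv}(\alpha)>0$ for all $\{u,v\}\in E^+$. For $S\subset V$, $\overline S=V\setminus S$ and $\partial S$ is the set of edges of $G^+$ with exactly one endpoint in $S$. *)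

theory Defs
  imports Complex_Main "Jordan_Normal_Form.Char_Poly"
begin

text \<open>The vertex set is \<open>{..<n}\<close>, so that vertices index the rows and columns of an
  \<open>n \<times> n\<close> matrix. The edge set may contain edges of weight zero.\<close>

definition weighted_graph :: "nat \<Rightarrow> nat set set \<Rightarrow> (nat \<Rightarrow> nat \<Rightarrow> real) \<Rightarrow> bool" where
  "weighted_graph n E w \<longleftrightarrow>
     E \<subseteq> {{u, v} | u v. u < n \<and> v < n \<and> u \<noteq> v} \<and>
     (\<forall>u v. w u v = w v u) \<and>
     (\<forall>u v. w u v \<noteq> 0 \<longrightarrow> {u, v} \<in> E)"

definition laplacian :: "nat \<Rightarrow> (nat \<Rightarrow> nat \<Rightarrow> real) \<Rightarrow> real mat" where
  "laplacian n w = mat n n (\<lambda>(u, v). if u = v then (\<Sum>x<n. w u x) else - w u v)"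

definition pos_edges :: "nat set set \<Rightarrow> (nat \<Rightarrow> nat \<Rightarrow> real) \<Rightarrow> nat set set" where
  "pos_edges E w = {{u, v} | u v. {u, v} \<in> E \<and> w u v > 0}"

definition pos_degree :: "nat \<Rightarrow> nat set set \<Rightarrow> (nat \<Rightarrow> nat \<Rightarrow> real) \<Rightarrow> nat \<Rightarrow> real" where
  "pos_degree n E w u = (\<Sum>v | v < n \<and> {u, v} \<in> pos_edges E w. w u v)"

text \<open>A path is represented by its set of edges. Paths visit no vertex twice, so their length
  is the cardinality of that set, and the paths from \<open>x\<close> to \<open>y\<close> are the same as those
  from \<open>y\<close> to \<open>x\<close>, as needed for sums over unordered pairs \<open>{x, y}\<close>.\<close>

definition path_edges :: "nat list \<Rightarrow> nat set set" where
  "path_edges xs = {{xs ! i, xs ! Suc i} | i. Suc i < length xs}"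

definition paths :: "nat set set \<Rightarrow> nat \<Rightarrow> nat \<Rightarrow> nat set set set" where
  "paths F x y = {path_edges xs | xs. xs \<noteq> [] \<and> hd xs = x \<and> last xs = y \<and>
                                      distinct xs \<and> path_edges xs \<subseteq> F}"

definition connected_graph :: "nat \<Rightarrow> nat set set \<Rightarrow> bool" where
  "connected_graph n F \<longleftrightarrow> (\<forall>x<n. \<forall>y<n. paths F x y \<noteq> {})"

text \<open>Only the values of \<open>\<alpha>\<close> on paths between endpoints of edges in \<open>E\<close> are constrained;
  the other values are never used.\<close>

definition routing ::
    "nat set set \<Rightarrow> (nat \<Rightarrow> nat \<Rightarrow> real) \<Rightarrow> (nat set set \<Rightarrow> real) \<Rightarrow> bool" where
  "routing E w \<alpha> \<longleftrightarrow>
     (\<forall>x y. {x, y} \<in> E \<longrightarrow>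
        (\<forall>p \<in> paths (pos_edges E w) x y. \<alpha> p \<in> {0..1} \<and> \<alpha> p > 0) \<and>
        (\<Sum>p \<in> paths (pos_edges E w) x y. \<alpha> p) = 1)"

text \<open>The condition \<open>x < y\<close> selects each unordered pair \<open>{x, y}\<close> exactly once.\<close>

definition omega ::
    "nat \<Rightarrow> nat set set \<Rightarrow> (nat \<Rightarrow> nat \<Rightarrow> real) \<Rightarrow> real vec \<Rightarrow> (nat set set \<Rightarrow> real) \<Rightarrow> nat \<Rightarrow> nat \<Rightarrow> real"
  where
  "omega n E w \<phi> \<alpha> u v =
     w u v * \<phi> $ u * \<phi> $ v -
     (\<Sum>(x, y) \<in> {(x, y). x < y \<and> y < n \<and> {x, y} \<in> E \<and> w x y < 0}.
        \<Sum>p \<in> {p \<in> paths (pos_edges E w) x y. {u, v} \<in> p}.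
          \<bar>w x y\<bar> * real (card p) * \<alpha> p * \<phi> $ x * \<phi> $ y)"

definition admissible ::
    "nat \<Rightarrow> nat set set \<Rightarrow> (nat \<Rightarrow> nat \<Rightarrow> real) \<Rightarrow> real vec \<Rightarrow> (nat set set \<Rightarrow> real) \<Rightarrow> bool" where
  "admissible n E w \<phi> \<alpha> \<longleftrightarrow>
     routing E w \<alpha> \<and> (\<forall>u v. {u, v} \<in> pos_edges E w \<longrightarrow> omega n E w \<phi> \<alpha> u v > 0)"

text \<open>Each edge of the boundary of \<open>S\<close> occurs once below, oriented from \<open>S\<close> to its complement.\<close>

definition cut_weight ::
    "nat \<Rightarrow> nat set set \<Rightarrow> (nat \<Rightarrow> nat \<Rightarrow> real) \<Rightarrow> real vec \<Rightarrow> (nat set set \<Rightarrow> real) \<Rightarrow> nat set \<Rightarrow> real"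
  where
  "cut_weight n E w \<phi> \<alpha> S =
     (\<Sum>(u, v) \<in> {(u, v). u \<in> S \<and> v \<in> {..<n} - S \<and> {u, v} \<in> pos_edges E w}. omega n E w \<phi> \<alpha> u v)"

definition h_routing ::
    "nat \<Rightarrow> nat set set \<Rightarrow> (nat \<Rightarrow> nat \<Rightarrow> real) \<Rightarrow> real vec \<Rightarrow> (nat set set \<Rightarrow> real) \<Rightarrow> real" where
  "h_routing n E w \<phi> \<alpha> =
     (MIN S \<in> {S. S \<noteq> {} \<and> S \<subset> {..<n}}.
        MAX S' \<in> {S, {..<n} - S}. cut_weight n E w \<phi> \<alpha> S / (\<Sum>u\<in>S'. (\<phi> $ u)\<^sup>2))"

text \<open>If \<open>n \<ge> 2\<close>, the positive part is connected, \<open>\<phi> \<ge> 0\<close> and an admissible routing exists, then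
  \<open>\<phi> > 0\<close> and \<open>omega n E w \<phi> \<alpha> u v \<le> w u v * \<phi> $ u * \<phi> $ v\<close>, so this is the supremum of a
  nonempty set bounded above.\<close>

definition h_sup ::
    "nat \<Rightarrow> nat set set \<Rightarrow> (nat \<Rightarrow> nat \<Rightarrow> real) \<Rightarrow> real vec \<Rightarrow> real" where
  "h_sup n E w \<phi> = (SUP \<alpha> \<in> {\<alpha>. admissible n E w \<phi> \<alpha>}. h_routing n E w \<phi> \<alpha>)"

text \<open>The eigenvalues listed in increasing order and with multiplicity.\<close>

definition sorted_eigenvalues :: "nat \<Rightarrow> real mat \<Rightarrow> (nat \<Rightarrow> real) \<Rightarrow> bool" where
  "sorted_eigenvalues n H lam \<longleftrightarrow>
     char_poly H = (\<Prod>i<n. [:- lam i, 1:]) \<and> (\<forall>i j. i \<le> j \<longrightarrow> j < n \<longrightarrow> lam i \<le> lam j)"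

end

theory Submission
  imports Defs "Jordan_Normal_Form.Schur_Decomposition" "HOL-Analysis.Convex"
begin

text \<open>
  Write a vector as \<open>f = \<phi> g\<close>. Since \<open>\<phi>\<close> is an eigenvector for \<open>\<lambda>\<^sub>0\<close>, the quadratic form of \<open>H - \<lambda>\<^sub>0\<close> at \<open>f\<close> is
  the energy of \<open>g\<close> for the conductances \<open>w\<^sub>u\<^sub>v \<phi>(u) \<phi>(v)\<close> (\<open>ground_state_transform\<close>). Negative conductances are
  harmful, but \<open>(g x - g y)\<^sup>2\<close> is at most the length of any path from \<open>x\<close> to \<open>y\<close> times the energy of \<open>g\<close> along
  that path, so a negative edge can be charged to the positive edges on the paths chosen by \<open>\<alpha>\<close>.
  What remains is an energy with the nonnegative conductances \<open>\<omega>\<^sub>u\<^sub>v(\<alpha>)\<close>, which bounds the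
  quadratic form from below (\<open>routed_energy_le\<close>).

  The spectral theorem for real symmetric matrices provides a nonzero test vector that is orthogonal to
  \<open>\<phi>\<close> and has Rayleigh quotient at most \<open>\<lambda>\<^sub>1\<close>. The corresponding \<open>g\<close> has mean zero for the vertex
  measure \<open>\<phi>\<^sup>2\<close> and energy at most \<open>\<mu> = \<lambda>\<^sub>1 - \<lambda>\<^sub>0\<close> times its mass, and \<open>h\<^sub>\<alpha>\<close> is precisely the Cheeger constant
  of the weighted graph with conductances \<open>\<omega>(\<alpha>)\<close> and measure \<open>\<phi>\<^sup>2\<close>. Cheeger's inequality in its sharp form
  (\<open>cheeger\<close>) therefore gives \<open>h\<^sub>\<alpha>\<^sup>2 \<le> \<mu> (2 c - \<mu>)\<close> for every \<open>c \<ge> \<mu>\<close> such that each vertex \<open>z\<close> has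
  \<open>\<omega>(\<alpha>)\<close>-degree at most \<open>c \<phi>(z)\<^sup>2\<close>. The energy comparison at the indicator function of \<open>z\<close>
  shows that \<open>c = \<rho>\<close> is possible, since diagonal entries of \<open>H\<close> do not exceed \<open>\<lambda>\<^sub>n\<^sub>-\<^sub>1\<close>.
  The resulting bound on \<open>h\<^sub>\<alpha>\<close> does not depend on \<open>\<alpha>\<close>, so it holds for the supremum. Degrees in
  \<open>G\<^sup>+\<close> are nonnegative, so \<open>d_max + \<rho> \<ge> \<rho>\<close>, and as \<open>\<mu> (2 c - \<mu>)\<close> increases with \<open>c\<close>, the bound holds with
  \<open>c = d_max + \<rho>\<close>. Solving the quadratic inequality for \<open>\<mu>\<close> gives the claim.
\<close>

section \<open>Real symmetric matrices\<close>

text \<open>Vectors are functions of which only the values below \<open>n\<close> matter; sums and linear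
  combinations of them then carry no dimension side conditions.\<close>

definition dot :: "nat \<Rightarrow> (nat \<Rightarrow> real) \<Rightarrow> (nat \<Rightarrow> real) \<Rightarrow> real" where
  "dot n x y = (\<Sum>i<n. x i * y i)"

lemma dot_commute: "dot n x y = dot n y x"
  by (simp add: dot_def mult.commute)

lemma dot_add_right: "dot n x (\<lambda>i. y i + z i) = dot n x y + dot n x z"
  by (simp add: dot_def algebra_simps sum.distrib)

lemma dot_diff_right: "dot n x (\<lambda>i. y i - z i) = dot n x y - dot n x z"
  by (simp add: dot_def algebra_simps sum_subtractf)

lemma dot_scale_right: "dot n x (\<lambda>i. c * y i) = c * dot n x y"
  by (simp add: dot_def algebra_simps sum_distrib_left)

lemma dot_sum_right: "dot n x (\<lambda>i. \<Sum>j\<in>J. c j * y j i) = (\<Sum>j\<in>J. c j * dot n x (y j))"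
  unfolding dot_def sum_distrib_left
  by (subst sum.swap) (simp add: algebra_simps)

lemmas dot_linear = dot_add_right dot_diff_right dot_scale_right dot_sum_right

lemma dot_cong: "(\<And>i. i < n \<Longrightarrow> x i = x' i) \<Longrightarrow> (\<And>i. i < n \<Longrightarrow> y i = y' i) \<Longrightarrow> dot n x y = dot n x' y'"
  by (simp add: dot_def)

lemma dot_self_nonneg: "dot n x x \<ge> 0"
  by (simp add: dot_def sum_nonneg)

lemma dot_self_eq_0: "dot n x x = 0 \<longleftrightarrow> (\<forall>i<n. x i = 0)"
  by (auto simp: dot_def sum_nonneg_eq_0_iff)

lemma dot_matrix_symmetric:
  assumes "\<And>i j. i < n \<Longrightarrow> j < n \<Longrightarrow> a i j = a j i"
  shows "dot n x (\<lambda>i. dot n (a i) y) = dot n (\<lambda>i. dot n (a i) x) y"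
proof -
  have "dot n x (\<lambda>i. dot n (a i) y) = (\<Sum>i<n. \<Sum>j<n. x i * (a i j * y j))"
    by (simp add: dot_def sum_distrib_left)
  also have "\<dots> = (\<Sum>j<n. \<Sum>i<n. x i * (a i j * y j))" by (rule sum.swap)
  also have "\<dots> = (\<Sum>j<n. \<Sum>i<n. a j i * x i * y j)"
    using assms by (intro sum.cong refl) (auto simp: algebra_simps)
  finally show ?thesis by (simp add: dot_def sum_distrib_right)
qed

text \<open>The columns of the matrix that triangularizes \<open>A\<close> span a flag of invariant subspaces, with the
  eigenvalues on the diagonal in the prescribed order. The rows \<open>y\<close> of the inverse matrix are kept as
  well: being dual to the columns, they witness that each column lies outside the span of its
  predecessors.\<close>

lemma schur_flag:
  fixes A :: "real mat"
  assumes A: "A \<in> carrier_mat n n" and cp: "char_poly A = (\<Prod>i<n. [:- lam i, 1:])"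
  obtains p y :: "nat \<Rightarrow> nat \<Rightarrow> real" and b :: "nat \<Rightarrow> nat \<Rightarrow> real" where
    "\<And>i k. i < n \<Longrightarrow> k < n \<Longrightarrow>
       dot n (\<lambda>j. A $$ (i, j)) (p k) = lam k * p k i + (\<Sum>j<k. b j k * p j i)"
    "\<And>j k. j < n \<Longrightarrow> k < n \<Longrightarrow> dot n (y k) (p j) = (if j = k then 1 else 0)"
proof -
  define es where "es = map lam [0..<n]"
  obtain B P Q where dec: "schur_decomposition A es = (B, P, Q)" by (metis prod_cases3)
  have "char_poly A = (\<Prod>e\<leftarrow>es. [:- e, 1:])"
    unfolding cp es_def
    using prod.distinct_set_conv_list[of "[0..<n]" "\<lambda>i. [:- lam i, 1:]"]
    by (simp add: lessThan_atLeast0 comp_def)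
  from schur_decomposition[OF A this dec]
  have sim: "similar_mat_wit A B P Q" and up: "upper_triangular B" and dg: "diag_mat B = es"
    by auto
  note w = similar_mat_witD2[OF A sim]
  have AP: "A * P = P * B"
  proof -
    have "A * P = P * B * (Q * P)" unfolding w(3) using w by (simp add: assoc_mult_mat[of _ n n _ n _ n])
    then show ?thesis using w by simp
  qed
  have diag: "B $$ (k, k) = lam k" if "k < n" for k
  proof -
    have "diag_mat B ! k = lam k" unfolding dg es_def using that by simp
    then show ?thesis using that w(5) by (simp add: diag_mat_def)
  qed
  show ?thesis
  proof (rule that[of "\<lambda>k i. P $$ (i, k)" "\<lambda>j k. B $$ (j, k)" "\<lambda>k i. Q $$ (k, i)"])
    fix i k assume ik: "i < n" "k < n"
    have "dot n (\<lambda>j. A $$ (i, j)) (\<lambda>i. P $$ (i, k)) = (A * P) $$ (i, k)"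
      using ik w by (auto simp: dot_def scalar_prod_def lessThan_atLeast0)
    also have "\<dots> = (P * B) $$ (i, k)" by (simp add: AP)
    also have "\<dots> = (\<Sum>j<n. P $$ (i, j) * B $$ (j, k))"
      using ik w by (auto simp: scalar_prod_def lessThan_atLeast0)
    also have "\<dots> = (\<Sum>j<Suc k. P $$ (i, j) * B $$ (j, k))"
      using ik up w(5) by (intro sum.mono_neutral_right) (auto simp: upper_triangular_def)
    finally show "dot n (\<lambda>j. A $$ (i, j)) (\<lambda>i. P $$ (i, k)) =
        lam k * P $$ (i, k) + (\<Sum>j<k. B $$ (j, k) * P $$ (i, j))"
      using diag[OF ik(2)] by (simp add: mult.commute)
  next
    fix j k assume jk: "j < n" "k < n"
    have "dot n (\<lambda>i. Q $$ (k, i)) (\<lambda>i. P $$ (i, j)) = (Q * P) $$ (k, j)"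
      using jk w(6,7) by (auto simp: dot_def scalar_prod_def lessThan_atLeast0)
    then show "dot n (\<lambda>i. Q $$ (k, i)) (\<lambda>i. P $$ (i, j)) = (if j = k then 1 else 0)"
      using jk w(2) by auto
  qed
qed

text \<open>Gram--Schmidt applied to an invariant flag of a symmetric matrix produces eigenvectors: the new
  vector is orthogonal to the previous subspace, hence by symmetry so is its image, and the image
  therefore has no component in that subspace. Equality of the spans of the first \<open>k\<close> vectors is
  expressed by equality of their orthogonal complements, which avoids recording coefficients.\<close>

lemma invariant_flag_orthonormal_eigenvectors:
  assumes sym: "\<And>i j. i < n \<Longrightarrow> j < n \<Longrightarrow> a i j = a j i"
    and flag: "\<And>i k. i < n \<Longrightarrow> k < n \<Longrightarrow> dot n (a i) (p k) = lam k * p k i + (\<Sum>j<k. b j k * p j i)"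
    and dual: "\<And>j k. j < n \<Longrightarrow> k < n \<Longrightarrow> dot n (y k) (p j) = (if j = k then 1 else 0)"
    and "k \<le> n"
  shows "\<exists>q. (\<forall>j<k. \<forall>i<n. dot n (a i) (q j) = lam j * q j i) \<and>
             (\<forall>j<k. \<forall>l<k. dot n (q j) (q l) = (if j = l then 1 else 0)) \<and>
             (\<forall>x. (\<forall>j<k. dot n x (q j) = 0) \<longleftrightarrow> (\<forall>j<k. dot n x (p j) = 0))"
    (is "\<exists>q. ?good k q")
  using \<open>k \<le> n\<close>
proof (induction k)
  case 0
  show ?case by simp
next
  case (Suc k)
  then have k: "k < n" by simp
  from Suc.IH[OF less_imp_le[OF k]] obtain q where q: "?good k q" by (rule exE)
  have eig: "dot n (a i) (q j) = lam j * q j i" if "j < k" "i < n" for i j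
    using q that by simp
  have orth: "dot n (q j) (q l) = (if j = l then 1 else 0)" if "j < k" "l < k" for j l
    using q that by simp
  have perp: "(\<forall>j<k. dot n x (q j) = 0) \<longleftrightarrow> (\<forall>j<k. dot n x (p j) = 0)" for x
    using conjunct2[OF conjunct2[OF q]] by (rule spec)
  \<comment> \<open>Orthogonal projection of the next flag vector away from the eigenvectors found so far.\<close>
  define c where "c j = dot n (p k) (q j)" for j
  define r where "r i = p k i - (\<Sum>j<k. c j * q j i)" for i
  have dot_r: "dot n x r = dot n x (p k) - (\<Sum>j<k. c j * dot n x (q j))" for x
    unfolding r_def[abs_def] by (simp add: dot_linear)
  have r_perp: "dot n (q l) r = 0" if "l < k" for l
  proof -
    have "(\<Sum>j<k. c j * dot n (q l) (q j)) = (\<Sum>j<k. if j = l then c j else 0)"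
      using that by (intro sum.cong) (auto simp: orth)
    then show ?thesis using that by (simp add: dot_r) (simp add: c_def dot_commute[of n "q l" "p k"])
  qed
  \<comment> \<open>The dual vector annihilates the earlier span but not the next flag vector, so the projection is nonzero.\<close>
  have "\<forall>j<k. dot n (y k) (q j) = 0"
    unfolding perp using dual k by auto
  then have "dot n (y k) r = 1"
    using dual k by (simp add: dot_r)
  then have "\<not> (\<forall>i<n. r i = 0)" by (force simp: dot_def intro: sum.neutral)
  then have rr: "dot n r r > 0"
    using dot_self_eq_0[of n r] dot_self_nonneg[of n r] by (metis order_le_less)
  \<comment> \<open>The defect of the eigenvector equation lies in the earlier span and is orthogonal to it.\<close>
  define s where "s i = (\<Sum>j<k. b j k * p j i) + (\<Sum>j<k. (c j * (lam k - lam j)) * q j i)" for i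
  have Ar: "dot n (a i) r = lam k * r i + s i" if "i < n" for i
  proof -
    have "dot n (a i) r = lam k * p k i + (\<Sum>j<k. b j k * p j i) - (\<Sum>j<k. c j * (lam j * q j i))"
      using that k by (simp add: dot_r flag eig)
    then show ?thesis
      by (simp add: r_def s_def algebra_simps sum_distrib_left sum_subtractf)
  qed
  have "dot n s (q l) = 0" if l: "l < k" for l
  proof -
    have "dot n (q l) (\<lambda>i. dot n (a i) r) = dot n (q l) (\<lambda>i. lam k * r i + s i)"
      by (rule dot_cong) (simp_all add: Ar)
    then have "dot n (q l) s = dot n (q l) (\<lambda>i. dot n (a i) r)"
      using r_perp[OF l] by (simp add: dot_linear)
    also have "\<dots> = dot n (\<lambda>i. dot n (a i) (q l)) r"
      using dot_matrix_symmetric[of n a, OF sym] by blast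
    also have "\<dots> = dot n (\<lambda>i. lam l * q l i) r"
      by (rule dot_cong) (simp_all add: eig l)
    also have "\<dots> = 0"
      using r_perp[OF l] by (simp add: dot_commute[of n "\<lambda>i. lam l * q l i" r] dot_commute[of n "q l" r] dot_linear)
    finally show ?thesis by (simp add: dot_commute)
  qed
  then have sq: "\<forall>j<k. dot n s (q j) = 0" by blast
  with perp have sp: "\<forall>j<k. dot n s (p j) = 0" by blast
  have "dot n s s = dot n s (\<lambda>i. (\<Sum>j<k. b j k * p j i) + (\<Sum>j<k. (c j * (lam k - lam j)) * q j i))"
    by (rule dot_cong) (simp_all add: s_def)
  also have "\<dots> = 0" using sq sp by (simp only: dot_linear) simp
  finally have s0: "s i = 0" if "i < n" for i
    using that dot_self_eq_0 by blast
  define z where "z = 1 / sqrt (dot n r r)"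
  have z: "z \<noteq> 0" "z * (z * dot n r r) = 1"
    using rr by (auto simp: z_def)
  define q' where "q' = q(k := (\<lambda>i. z * r i))"
  have zr: "dot n x (\<lambda>i. z * r i) = z * dot n x r" "dot n (\<lambda>i. z * r i) x = z * dot n x r" for x
    by (simp_all add: dot_linear dot_commute[of n "\<lambda>i. z * r i" x] dot_commute[of n r x])
  have eig': "\<forall>j<Suc k. \<forall>i<n. dot n (a i) (q' j) = lam j * q' j i"
    by (auto simp: q'_def less_Suc_eq eig zr Ar s0)
  have orth': "\<forall>j<Suc k. \<forall>l<Suc k. dot n (q' j) (q' l) = (if j = l then 1 else 0)"
    using z by (auto simp: q'_def less_Suc_eq orth zr r_perp)
  have perp': "(\<forall>j<Suc k. dot n x (q' j) = 0) \<longleftrightarrow> (\<forall>j<Suc k. dot n x (p j) = 0)" for x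
  proof -
    have "(\<forall>j<Suc k. dot n x (q' j) = 0) \<longleftrightarrow> (\<forall>j<k. dot n x (q j) = 0) \<and> dot n x r = 0"
      using z by (auto simp: q'_def less_Suc_eq zr)
    also have "\<dots> \<longleftrightarrow> (\<forall>j<k. dot n x (q j) = 0) \<and> dot n x (p k) = 0"
      by (auto simp: dot_r)
    finally show ?thesis unfolding perp by (auto simp: less_Suc_eq)
  qed
  have "?good (Suc k) q'" by (rule conjI[OF eig' conjI[OF orth' allI[OF perp']]])
  then show ?case by (intro exI[of _ q'])
qed

lemma real_symmetric_eigenbasis:
  fixes A :: "real mat"
  assumes A: "A \<in> carrier_mat n n"
    and sym: "transpose_mat A = A"
    and cp: "char_poly A = (\<Prod>i<n. [:- lam i, 1:])"
  shows "\<exists>q. (\<forall>k<n. \<forall>i<n. dot n (\<lambda>j. A $$ (i, j)) (q k) = lam k * q k i) \<and>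
             (\<forall>k<n. \<forall>l<n. dot n (q k) (q l) = (if k = l then 1 else 0))"
proof (rule schur_flag[OF A cp])
  fix p y :: "nat \<Rightarrow> nat \<Rightarrow> real" and b
  assume flag:
    "\<And>i k. i < n \<Longrightarrow> k < n \<Longrightarrow>
       dot n (\<lambda>j. A $$ (i, j)) (p k) = lam k * p k i + (\<Sum>j<k. b j k * p j i)"
    "\<And>j k. j < n \<Longrightarrow> k < n \<Longrightarrow> dot n (y k) (p j) = (if j = k then 1 else 0)"
  have entries: "A $$ (i, j) = A $$ (j, i)" if "i < n" "j < n" for i j
    using that A sym by (metis carrier_matD index_transpose_mat(1))
  obtain q where q: "(\<forall>j<n. \<forall>i<n. dot n (\<lambda>l. A $$ (i, l)) (q j) = lam j * q j i) \<and>
      (\<forall>j<n. \<forall>l<n. dot n (q j) (q l) = (if j = l then 1 else 0)) \<and>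
      (\<forall>x. (\<forall>j<n. dot n x (q j) = 0) \<longleftrightarrow> (\<forall>j<n. dot n x (p j) = 0))"
    using invariant_flag_orthonormal_eigenvectors[of n "\<lambda>i j. A $$ (i, j)", OF entries flag order.refl]
    by (rule exE)
  show ?thesis
    by (rule exI[of _ q], rule conjI[OF conjunct1[OF q] conjunct1[OF conjunct2[OF q]]])
qed

text \<open>In an orthonormal eigenbasis, a diagonal entry is the average of the eigenvalues with respect to
  the squared coordinates of a standard basis vector.\<close>

lemma diagonal_entry_le_max_eigenvalue:
  fixes A :: "real mat"
  assumes A: "A \<in> carrier_mat n n"
    and sym: "transpose_mat A = A"
    and cp: "char_poly A = (\<Prod>i<n. [:- lam i, 1:])"
    and le: "\<And>k. k < n \<Longrightarrow> lam k \<le> M"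
    and u: "u < n"
  shows "A $$ (u, u) \<le> M"
proof -
  obtain q where q: "(\<forall>k<n. \<forall>i<n. dot n (\<lambda>j. A $$ (i, j)) (q k) = lam k * q k i) \<and>
      (\<forall>k<n. \<forall>l<n. dot n (q k) (q l) = (if k = l then 1 else 0))"
    using real_symmetric_eigenbasis[OF A sym cp] by (rule exE)
  have eig: "dot n (\<lambda>j. A $$ (i, j)) (q k) = lam k * q k i" if "k < n" "i < n" for k i
    using conjunct1[OF q] that by simp
  have orth: "dot n (q k) (q l) = (if k = l then 1 else 0)" if "k < n" "l < n" for k l
    using conjunct2[OF q] that by simp
  define R where "R = mat n n (\<lambda>(k, i). q k i)"
  have R: "R \<in> carrier_mat n n" by (simp add: R_def)
  \<comment> \<open>A square matrix with orthonormal rows has orthonormal columns.\<close>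
  have "R * transpose_mat R = 1\<^sub>m n"
    using orth by (intro eq_matI) (auto simp: R_def scalar_prod_def dot_def lessThan_atLeast0)
  then have "transpose_mat R * R = 1\<^sub>m n"
    using R by (intro mat_mult_left_right_inverse[of R n]) auto
  then have "(transpose_mat R * R) $$ (i, j) = 1\<^sub>m n $$ (i, j)" for i j by simp
  moreover have "(transpose_mat R * R) $$ (i, j) = (\<Sum>k<n. q k i * q k j)" if "i < n" "j < n" for i j
    using that by (simp add: R_def scalar_prod_def lessThan_atLeast0)
  ultimately have cols: "(\<Sum>k<n. q k i * q k j) = (if i = j then 1 else 0)" if "i < n" "j < n" for i j
    using that by (metis index_one_mat(1))
  have "A $$ (u, u) = (\<Sum>j<n. A $$ (u, j) * (\<Sum>k<n. q k j * q k u))"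
    using u by (simp add: cols if_distrib[of "\<lambda>x. _ * x"] cong: if_cong)
  also have "\<dots> = (\<Sum>k<n. dot n (\<lambda>j. A $$ (u, j)) (q k) * q k u)"
    unfolding dot_def sum_distrib_left sum_distrib_right
    by (subst sum.swap) (simp add: algebra_simps)
  also have "\<dots> = (\<Sum>k<n. lam k * (q k u * q k u))"
    using u by (simp add: eig mult.assoc)
  also have "\<dots> \<le> (\<Sum>k<n. M * (q k u * q k u))"
    using le by (intro sum_mono mult_right_mono) auto
  also have "\<dots> = M" using cols[OF u u] by (simp add: sum_distrib_left[symmetric])
  finally show ?thesis .
qed

text \<open>This is the upper half of the Courant--Fischer principle: the span of two orthonormal eigenvectors for
  the lowest two eigenvalues meets the hyperplane orthogonal to any \<open>\<phi>\<close>, including a ground state that is not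
  a multiple of the first basis vector, as can happen when \<open>lam 0 = lam 1\<close>.\<close>

lemma test_vector_orthogonal_to_given:
  fixes A :: "real mat" and \<phi> :: "nat \<Rightarrow> real"
  assumes n: "n \<ge> 2" and A: "A \<in> carrier_mat n n"
    and sym: "transpose_mat A = A"
    and cp: "char_poly A = (\<Prod>i<n. [:- lam i, 1:])"
    and le: "lam 0 \<le> lam 1"
  obtains f where "dot n f \<phi> = 0" "dot n f f > 0"
    "dot n f (\<lambda>i. dot n (\<lambda>j. A $$ (i, j)) f) \<le> lam 1 * dot n f f"
proof -
  obtain q where q: "(\<forall>k<n. \<forall>i<n. dot n (\<lambda>j. A $$ (i, j)) (q k) = lam k * q k i) \<and>
      (\<forall>k<n. \<forall>l<n. dot n (q k) (q l) = (if k = l then 1 else 0))"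
    using real_symmetric_eigenbasis[OF A sym cp] by (rule exE)
  have eig: "dot n (\<lambda>j. A $$ (i, j)) (q k) = lam k * q k i" if "k < n" "i < n" for k i
    using conjunct1[OF q] that by simp
  have orth: "dot n (q k) (q l) = (if k = l then 1 else 0)" if "k < n" "l < n" for k l
    using conjunct2[OF q] that by simp
  have "\<exists>\<beta> \<gamma>. \<beta> * dot n \<phi> (q 0) + \<gamma> * dot n \<phi> (q 1) = 0 \<and> \<beta>\<^sup>2 + \<gamma>\<^sup>2 > 0"
  proof (cases "dot n \<phi> (q 0) = 0")
    case True
    then show ?thesis by (intro exI[of _ 1] exI[of _ 0]) simp
  next
    case False
    then show ?thesis
      by (intro exI[of _ "dot n \<phi> (q 1)"] exI[of _ "- dot n \<phi> (q 0)"])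
         (simp add: add_nonneg_pos)
  qed
  then obtain \<beta> \<gamma> where bg: "\<beta> * dot n \<phi> (q 0) + \<gamma> * dot n \<phi> (q 1) = 0" "\<beta>\<^sup>2 + \<gamma>\<^sup>2 > 0"
    by blast
  define f where "f i = \<beta> * q 0 i + \<gamma> * q 1 i" for i
  have dot_f: "dot n x f = \<beta> * dot n x (q 0) + \<gamma> * dot n x (q 1)" for x
    unfolding f_def[abs_def] by (simp add: dot_linear)
  have f_q: "dot n f (q 0) = \<beta>" "dot n f (q (Suc 0)) = \<gamma>"
    using n by (simp_all add: dot_commute[of n f "q 0"] dot_commute[of n f "q (Suc 0)"] dot_f orth)
  then have ff: "dot n f f = \<beta>\<^sup>2 + \<gamma>\<^sup>2"
    by (simp add: dot_f[of f] power2_eq_square)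
  have "dot n f (\<lambda>i. dot n (\<lambda>j. A $$ (i, j)) f) =
        dot n f (\<lambda>i. \<beta> * (lam 0 * q 0 i) + \<gamma> * (lam 1 * q 1 i))"
    using n by (intro dot_cong) (simp_all add: dot_f eig)
  also have "\<dots> = lam 0 * \<beta>\<^sup>2 + lam 1 * \<gamma>\<^sup>2"
    by (simp add: dot_linear f_q power2_eq_square algebra_simps)
  also have "\<dots> \<le> lam 1 * \<beta>\<^sup>2 + lam 1 * \<gamma>\<^sup>2"
    using le by (intro add_mono mult_right_mono) auto
  finally have "dot n f (\<lambda>i. dot n (\<lambda>j. A $$ (i, j)) f) \<le> lam 1 * dot n f f"
    unfolding ff by (simp only: distrib_left)
  moreover have "dot n f \<phi> = 0"
    unfolding dot_commute[of n f \<phi>] dot_f by (rule bg(1))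
  ultimately show ?thesis using that bg(2) ff by simp
qed

section \<open>Cheeger's inequality for weighted graphs\<close>

text \<open>The conductances \<open>om\<close> and the vertex measure \<open>m\<close> enter Cheeger's inequality only through a
  bound \<open>c\<close> on the ratio of degree to measure and an isoperimetric constant \<open>h\<close> for the sets of at most half
  the total measure.\<close>

locale half_volume_isoperimetry =
  fixes V :: "'a set" and om :: "'a \<Rightarrow> 'a \<Rightarrow> real" and m :: "'a \<Rightarrow> real" and h c :: real
  assumes finite_V: "finite V"
    and om_sym: "om u v = om v u"
    and om_nonneg: "om u v \<ge> 0"
    and m_pos: "u \<in> V \<Longrightarrow> m u > 0"
    and degree_le: "u \<in> V \<Longrightarrow> (\<Sum>v\<in>V. om u v) \<le> c * m u"
    and h_nonneg: "h \<ge> 0"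
    and isoperimetry: "S \<noteq> {} \<Longrightarrow> S \<subseteq> V \<Longrightarrow> 2 * sum m S \<le> sum m V \<Longrightarrow>
      h * sum m S \<le> (\<Sum>u\<in>S. \<Sum>v\<in>V - S. om u v)"
begin

definition energy :: "('a \<Rightarrow> real) \<Rightarrow> real" where
  "energy f = (\<Sum>u\<in>V. \<Sum>v\<in>V. om u v * (f u - f v)\<^sup>2) / 2"

definition mass :: "('a \<Rightarrow> real) \<Rightarrow> real" where
  "mass f = (\<Sum>u\<in>V. m u * (f u)\<^sup>2)"

lemma energy_nonneg: "energy f \<ge> 0"
  unfolding energy_def by (intro divide_nonneg_pos sum_nonneg mult_nonneg_nonneg) (auto simp: om_nonneg)

lemma mass_nonneg: "mass f \<ge> 0"
  unfolding mass_def using m_pos by (intro sum_nonneg) (simp add: less_imp_le)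

text \<open>Both orientations of a boundary edge occur in the double sum.\<close>

lemma boundary_double_sum:
  assumes "S \<subseteq> V"
  shows "(\<Sum>u\<in>V. \<Sum>v\<in>V. om u v * of_bool ((u \<in> S) \<noteq> (v \<in> S))) =
         2 * (\<Sum>u\<in>S. \<Sum>v\<in>V - S. om u v)"
proof -
  have out: "(\<Sum>u\<in>V. \<Sum>v\<in>V. om u v * of_bool (u \<in> S \<and> v \<notin> S)) = (\<Sum>u\<in>S. \<Sum>v\<in>V - S. om u v)"
  proof -
    have "(\<Sum>u\<in>V. \<Sum>v\<in>V. om u v * of_bool (u \<in> S \<and> v \<notin> S)) =
          (\<Sum>u\<in>S. \<Sum>v\<in>V. om u v * of_bool (u \<in> S \<and> v \<notin> S))"
      using assms finite_V by (intro sum.mono_neutral_right) auto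
    also have "\<dots> = (\<Sum>u\<in>S. \<Sum>v\<in>V - S. om u v)"
      using assms finite_V by (intro sum.cong sum.mono_neutral_cong_right) auto
    finally show ?thesis .
  qed
  have "(\<Sum>u\<in>V. \<Sum>v\<in>V. om u v * of_bool (v \<in> S \<and> u \<notin> S)) =
        (\<Sum>u\<in>V. \<Sum>v\<in>V. om u v * of_bool (u \<in> S \<and> v \<notin> S))"
    by (subst sum.swap) (simp add: om_sym)
  moreover have "om u v * of_bool ((u \<in> S) \<noteq> (v \<in> S)) =
      om u v * of_bool (u \<in> S \<and> v \<notin> S) + om u v * of_bool (v \<in> S \<and> u \<notin> S)" for u v
    by auto
  ultimately show ?thesis by (simp add: sum.distrib out)
qed

text \<open>A discrete coarea formula: \<open>F\<close> is a positive combination of indicator functions of its superlevel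
  sets, all of which lie in its support and so have at most half the measure, and on each of them the inequality is
  the isoperimetric one. The induction removes the lowest level, which shrinks the support.\<close>

lemma coarea_bound:
  assumes "\<And>u. u \<in> V \<Longrightarrow> F u \<ge> 0"
    and "2 * sum m {u \<in> V. F u > 0} \<le> sum m V"
  shows "h * (\<Sum>u\<in>V. m u * F u) \<le> (\<Sum>u\<in>V. \<Sum>v\<in>V. om u v * \<bar>F u - F v\<bar>) / 2"
  using assms
proof (induction "card {u \<in> V. F u > 0}" arbitrary: F rule: less_induct)
  case less
  define S where "S = {u \<in> V. F u > 0}"
  have S: "S \<subseteq> V" "finite S" using finite_V by (auto simp: S_def)
  have off: "F u = 0" if "u \<in> V" "u \<notin> S" for u
    using less.prems(1)[of u] that by (auto simp: S_def)
  show ?case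
  proof (cases "S = {}")
    case True
    then have "F u = 0" if "u \<in> V" for u using off that by blast
    then show ?thesis by simp
  next
    case False
    \<comment> \<open>The least positive value of \<open>F\<close>; subtracting it on the support keeps \<open>F\<close> nonnegative.\<close>
    define t where "t = Min (F ` S)"
    have "t \<in> F ` S" using S False by (simp add: t_def)
    then obtain s where s: "s \<in> S" "t = F s" by blast
    have t: "t > 0" using s by (simp add: S_def)
    have t_le: "t \<le> F u" if "u \<in> S" for u using S that by (simp add: t_def)
    define F' where "F' u = F u - t * of_bool (u \<in> S)" for u
    have F'_nonneg: "F' u \<ge> 0" if "u \<in> V" for u
      using less.prems(1)[OF that] t_le[of u] by (simp add: F'_def)
    have "u \<in> S" if "u \<in> V" "F' u > 0" for u
      using off[of u] that by (cases "u \<in> S") (auto simp: F'_def)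
    then have sub: "{u \<in> V. F' u > 0} \<subseteq> S" by blast
    have "s \<notin> {u \<in> V. F' u > 0}" using s by (simp add: F'_def)
    with sub s have psub: "{u \<in> V. F' u > 0} \<subset> S" by blast
    have "sum m {u \<in> V. F' u > 0} \<le> sum m S"
      using sub S m_pos by (intro sum_mono2) (auto intro: less_imp_le)
    then have "h * (\<Sum>u\<in>V. m u * F' u) \<le> (\<Sum>u\<in>V. \<Sum>v\<in>V. om u v * \<bar>F' u - F' v\<bar>) / 2"
      using less.prems(2) psub S F'_nonneg
      by (intro less.hyps) (auto simp: S_def[symmetric] intro: psubset_card_mono)
    moreover have "t * (h * sum m S) \<le> t * (\<Sum>u\<in>S. \<Sum>v\<in>V - S. om u v)"
      using isoperimetry[OF False S(1)] less.prems(2) t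
      by (intro mult_left_mono) (auto simp: S_def)
    moreover have "(\<Sum>u\<in>V. m u * F u) = (\<Sum>u\<in>V. m u * F' u) + t * sum m S"
    proof -
      have "(\<Sum>u\<in>V. m u * F u) = (\<Sum>u\<in>V. m u * F' u + t * (m u * of_bool (u \<in> S)))"
        by (intro sum.cong) (auto simp: F'_def algebra_simps)
      also have "\<dots> = (\<Sum>u\<in>V. m u * F' u) + t * (\<Sum>u\<in>V. m u * of_bool (u \<in> S))"
        by (simp add: sum.distrib sum_distrib_left)
      also have "(\<Sum>u\<in>V. m u * of_bool (u \<in> S)) = sum m S"
        using S finite_V by (intro sum.mono_neutral_cong_right) auto
      finally show ?thesis .
    qed
    moreover have "(\<Sum>u\<in>V. \<Sum>v\<in>V. om u v * \<bar>F u - F v\<bar>) =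
        (\<Sum>u\<in>V. \<Sum>v\<in>V. om u v * \<bar>F' u - F' v\<bar>) + t * (2 * (\<Sum>u\<in>S. \<Sum>v\<in>V - S. om u v))"
    proof -
      have "\<bar>F u - F v\<bar> = \<bar>F' u - F' v\<bar> + t * of_bool ((u \<in> S) \<noteq> (v \<in> S))"
        if "u \<in> V" "v \<in> V" for u v
        using off that t_le[of u] t_le[of v] t by (auto simp: F'_def)
      then have "(\<Sum>u\<in>V. \<Sum>v\<in>V. om u v * \<bar>F u - F v\<bar>) =
          (\<Sum>u\<in>V. \<Sum>v\<in>V. om u v * \<bar>F' u - F' v\<bar> + t * (om u v * of_bool ((u \<in> S) \<noteq> (v \<in> S))))"
        by (intro sum.cong refl) (simp add: algebra_simps)
      also have "\<dots> = (\<Sum>u\<in>V. \<Sum>v\<in>V. om u v * \<bar>F' u - F' v\<bar>) +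
          t * (\<Sum>u\<in>V. \<Sum>v\<in>V. om u v * of_bool ((u \<in> S) \<noteq> (v \<in> S)))"
        by (simp add: sum.distrib sum_distrib_left)
      finally show ?thesis by (simp only: boundary_double_sum[OF S(1)])
    qed
    ultimately show ?thesis by (simp add: algebra_simps)
  qed
qed

text \<open>Apply the coarea bound to \<open>f\<^sup>2\<close>, factor \<open>\<bar>f u\<^sup>2 - f v\<^sup>2\<bar>\<close> as \<open>\<bar>f u - f v\<bar> (f u + f v)\<close>, and use the
  Cauchy--Schwarz inequality. Writing \<open>(f u + f v)\<^sup>2\<close> as \<open>2 f u\<^sup>2 + 2 f v\<^sup>2 - (f u - f v)\<^sup>2\<close>, and not dropping
  the last term, gives the sharp form of the bound, with a square root, instead of the usual \<open>h\<^sup>2 / (2 c)\<close>.\<close>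

lemma one_sided_cheeger:
  assumes nonneg: "\<And>u. u \<in> V \<Longrightarrow> f u \<ge> 0"
    and half: "2 * sum m {u \<in> V. f u > 0} \<le> sum m V"
  shows "(h * mass f)\<^sup>2 \<le> energy f * (2 * c * mass f - energy f)"
proof -
  let ?P = "V \<times> V"
  define a where "a = (\<lambda>(u, v). sqrt (om u v) * \<bar>f u - f v\<bar>)"
  define b where "b = (\<lambda>(u, v). sqrt (om u v) * (f u + f v))"
  define Z where "Z = (\<Sum>u\<in>V. \<Sum>v\<in>V. om u v * (f u + f v)\<^sup>2)"
  have pairs: "(\<Sum>x\<in>?P. g x) = (\<Sum>u\<in>V. \<Sum>v\<in>V. g (u, v))" for g :: "'a \<times> 'a \<Rightarrow> real"
    by (simp add: sum.cartesian_product)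
  have half2: "2 * sum m {u \<in> V. (f u)\<^sup>2 > 0} \<le> sum m V"
  proof -
    have "{u \<in> V. (f u)\<^sup>2 > 0} = {u \<in> V. f u > 0}" using nonneg by force
    with half show ?thesis by simp
  qed
  have "h * mass f \<le> (\<Sum>u\<in>V. \<Sum>v\<in>V. om u v * \<bar>(f u)\<^sup>2 - (f v)\<^sup>2\<bar>) / 2"
    unfolding mass_def by (rule coarea_bound[OF _ half2]) simp
  also have "(\<Sum>u\<in>V. \<Sum>v\<in>V. om u v * \<bar>(f u)\<^sup>2 - (f v)\<^sup>2\<bar>) = (\<Sum>x\<in>?P. a x * b x)"
    unfolding pairs
  proof (intro sum.cong refl)
    fix u v assume uv: "u \<in> V" "v \<in> V"
    have "\<bar>(f u)\<^sup>2 - (f v)\<^sup>2\<bar> = \<bar>f u - f v\<bar> * (f u + f v)"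
      using nonneg[OF uv(1)] nonneg[OF uv(2)]
      by (simp add: power2_eq_square square_diff_square_factored abs_mult)
    moreover have "om u v = sqrt (om u v) * sqrt (om u v)" by (simp add: om_nonneg)
    ultimately show "om u v * \<bar>(f u)\<^sup>2 - (f v)\<^sup>2\<bar> = a (u, v) * b (u, v)"
      by (simp add: a_def b_def)
  qed
  finally have "(2 * (h * mass f))\<^sup>2 \<le> (\<Sum>x\<in>?P. a x * b x)\<^sup>2"
    using h_nonneg mass_nonneg by (intro power_mono) auto
  also have "\<dots> \<le> (\<Sum>x\<in>?P. (a x)\<^sup>2) * (\<Sum>x\<in>?P. (b x)\<^sup>2)"
    by (rule Cauchy_Schwarz_ineq_sum)
  also have "(\<Sum>x\<in>?P. (a x)\<^sup>2) = 2 * energy f"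
    unfolding pairs by (simp add: a_def energy_def power_mult_distrib om_nonneg)
  also have "(\<Sum>x\<in>?P. (b x)\<^sup>2) = Z"
    unfolding pairs by (simp add: b_def Z_def power_mult_distrib om_nonneg)
  finally have 1: "4 * (h * mass f)\<^sup>2 \<le> 2 * energy f * Z" by (simp add: power_mult_distrib)
  have "Z + 2 * energy f = (\<Sum>u\<in>V. \<Sum>v\<in>V. 2 * (om u v * (f u)\<^sup>2) + 2 * (om u v * (f v)\<^sup>2))"
  proof -
    have "2 * (om u v * (f u)\<^sup>2) + 2 * (om u v * (f v)\<^sup>2) =
        om u v * (f u + f v)\<^sup>2 + om u v * (f u - f v)\<^sup>2" for u v
      by (simp add: power2_sum power2_diff distrib_left right_diff_distrib)
    then show ?thesis by (simp add: Z_def energy_def sum.distrib)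
  qed
  also have "\<dots> = 2 * (\<Sum>u\<in>V. \<Sum>v\<in>V. om u v * (f u)\<^sup>2) + 2 * (\<Sum>u\<in>V. \<Sum>v\<in>V. om u v * (f v)\<^sup>2)"
    by (simp add: sum.distrib sum_distrib_left)
  also have "(\<Sum>u\<in>V. \<Sum>v\<in>V. om u v * (f v)\<^sup>2) = (\<Sum>u\<in>V. \<Sum>v\<in>V. om u v * (f u)\<^sup>2)"
    by (subst sum.swap) (simp add: om_sym)
  also have "(\<Sum>u\<in>V. \<Sum>v\<in>V. om u v * (f u)\<^sup>2) = (\<Sum>u\<in>V. (\<Sum>v\<in>V. om u v) * (f u)\<^sup>2)"
    by (simp add: sum_distrib_right)
  finally have "Z + 2 * energy f = 4 * (\<Sum>u\<in>V. (\<Sum>v\<in>V. om u v) * (f u)\<^sup>2)" by simp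
  also have "\<dots> \<le> 4 * (\<Sum>u\<in>V. (c * m u) * (f u)\<^sup>2)"
    using degree_le by (intro mult_left_mono sum_mono mult_right_mono) auto
  also have "\<dots> = 4 * c * mass f" by (simp add: mass_def sum_distrib_left algebra_simps)
  finally have "Z \<le> 2 * (2 * c * mass f - energy f)" by simp
  then have "2 * energy f * Z \<le> 2 * energy f * (2 * (2 * c * mass f - energy f))"
    using energy_nonneg by (intro mult_left_mono) auto
  with 1 have "4 * (h * mass f)\<^sup>2 \<le> 2 * energy f * (2 * (2 * c * mass f - energy f))"
    by (rule order.trans)
  then show ?thesis by (simp add: algebra_simps)
qed

text \<open>The least value whose sublevel set has at least half the measure is a median.\<close>

lemma weighted_median:
  fixes g :: "'a \<Rightarrow> real"
  assumes "V \<noteq> {}"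
  obtains t where "2 * sum m {u \<in> V. g u > t} \<le> sum m V" "2 * sum m {u \<in> V. g u < t} \<le> sum m V"
proof -
  define T where "T = {t \<in> g ` V. sum m V \<le> 2 * sum m {u \<in> V. g u \<le> t}}"
  have fT: "finite T" using finite_V by (simp add: T_def)
  have "sum m V \<ge> 0" using m_pos by (intro sum_nonneg) (simp add: less_imp_le)
  moreover have "{u \<in> V. g u \<le> Max (g ` V)} = V" using finite_V by auto
  ultimately have "Max (g ` V) \<in> T" using finite_V assms by (simp add: T_def)
  then have T: "Min T \<in> T" using fT Min_in by blast
  define t where "t = Min T"
  have V: "{u \<in> V. g u \<le> t} \<union> {u \<in> V. g u > t} = V" by auto
  have "sum m V = sum m ({u \<in> V. g u \<le> t} \<union> {u \<in> V. g u > t})" by (simp only: V)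
  also have "\<dots> = sum m {u \<in> V. g u \<le> t} + sum m {u \<in> V. g u > t}"
    using finite_V by (intro sum.union_disjoint) auto
  finally have "sum m V = sum m {u \<in> V. g u \<le> t} + sum m {u \<in> V. g u > t}" .
  moreover have "sum m V \<le> 2 * sum m {u \<in> V. g u \<le> t}"
  proof -
    have "t \<in> T" unfolding t_def by (rule T)
    then show ?thesis by (simp add: T_def)
  qed
  ultimately have up: "2 * sum m {u \<in> V. g u > t} \<le> sum m V" by linarith
  have low: "2 * sum m {u \<in> V. g u < t} \<le> sum m V"
  proof (cases "{u \<in> V. g u < t} = {}")
    case True
    then show ?thesis using \<open>sum m V \<ge> 0\<close> by (simp only:) simp
  next
    case False
    define L where "L = {u \<in> V. g u < t}"
    have L: "finite L" "L \<noteq> {}" using False finite_V by (auto simp: L_def)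
    define s where "s = Max (g ` L)"
    have "s \<in> g ` L" using L by (simp add: s_def)
    then have s: "s \<in> g ` V" "s < t" by (auto simp: L_def)
    have "g u \<le> s" if "u \<in> L" for u using L that by (simp add: s_def)
    then have "L = {u \<in> V. g u \<le> s}" using s(2) by (fastforce simp: L_def)
    moreover have "s \<notin> T" using s(2) fT Min_le[of T s] unfolding t_def by linarith
    ultimately show ?thesis using s by (simp add: T_def L_def)
  qed
  show ?thesis using that up low by blast
qed

text \<open>Shifting \<open>g\<close> by a median preserves the energy and, because \<open>g\<close> has mean zero, does not
  decrease the mass. The positive and negative parts of the shifted function have supports of at most half the
  measure, their masses add up, and their energies add up to at most the total energy; hence one of
  them has a Rayleigh quotient of at most \<open>\<mu>\<close>, and the one-sided bound applies to it.\<close>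

lemma cheeger:
  assumes ne: "V \<noteq> {}" and perp: "(\<Sum>u\<in>V. m u * g u) = 0" and pos: "mass g > 0"
    and small: "energy g \<le> \<mu> * mass g" and "\<mu> \<le> c"
  shows "h\<^sup>2 \<le> \<mu> * (2 * c - \<mu>)"
proof -
  obtain t where t: "2 * sum m {u \<in> V. g u > t} \<le> sum m V" "2 * sum m {u \<in> V. g u < t} \<le> sum m V"
    by (rule weighted_median[OF ne])
  define p where "p u = max (g u - t) 0" for u
  define q where "q u = max (t - g u) 0" for u
  have parts: "(h * mass p)\<^sup>2 \<le> energy p * (2 * c * mass p - energy p)"
    "(h * mass q)\<^sup>2 \<le> energy q * (2 * c * mass q - energy q)"
    using t by (auto intro!: one_sided_cheeger simp: p_def q_def less_max_iff_disj)
  have mass_pq: "mass p + mass q = mass g + t\<^sup>2 * sum m V"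
  proof -
    have part: "m u * (p u)\<^sup>2 + m u * (q u)\<^sup>2 = m u * (g u)\<^sup>2 - (2 * t) * (m u * g u) + t\<^sup>2 * m u" for u
    proof -
      have "(p u)\<^sup>2 + (q u)\<^sup>2 = (g u - t)\<^sup>2"
        by (cases "g u \<le> t") (simp_all add: p_def q_def max_def power2_commute[of t])
      then have "m u * (p u)\<^sup>2 + m u * (q u)\<^sup>2 = m u * (g u - t)\<^sup>2"
        by (simp only: distrib_left[symmetric])
      also have "\<dots> = m u * (g u)\<^sup>2 - (2 * t) * (m u * g u) + t\<^sup>2 * m u"
        by (simp add: power2_eq_square algebra_simps)
      finally show ?thesis .
    qed
    have "mass p + mass q = (\<Sum>u\<in>V. m u * (p u)\<^sup>2 + m u * (q u)\<^sup>2)"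
      by (simp only: mass_def sum.distrib)
    also have "\<dots> = (\<Sum>u\<in>V. m u * (g u)\<^sup>2 - (2 * t) * (m u * g u) + t\<^sup>2 * m u)"
      by (simp only: part)
    also have "\<dots> = mass g - (2 * t) * (\<Sum>u\<in>V. m u * g u) + t\<^sup>2 * sum m V"
      by (simp add: mass_def sum.distrib sum_subtractf sum_distrib_left)
    finally show ?thesis by (simp add: perp)
  qed
  have "sum m V \<ge> 0" using m_pos by (intro sum_nonneg) (simp add: less_imp_le)
  then have mass_ge: "mass p + mass q \<ge> mass g" by (simp add: mass_pq)
  have "energy p + energy q \<le> energy g"
  proof -
    have "(p u - p v)\<^sup>2 + (q u - q v)\<^sup>2 \<le> (g u - g v)\<^sup>2" for u v
    proof -
      \<comment> \<open>The two parts vary in opposite directions.\<close>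
      have "2 * ((p u - p v) * (q u - q v)) \<le> 0"
        by (auto simp: p_def q_def max_def mult_le_0_iff)
      moreover have "g u - g v = (p u - p v) - (q u - q v)"
        by (auto simp: p_def q_def max_def)
      moreover have "(x - y)\<^sup>2 = x\<^sup>2 + y\<^sup>2 - 2 * (x * y)" for x y :: real
        by (simp add: power2_diff)
      ultimately show ?thesis by simp
    qed
    then have "(\<Sum>u\<in>V. \<Sum>v\<in>V. om u v * ((p u - p v)\<^sup>2 + (q u - q v)\<^sup>2)) \<le>
               (\<Sum>u\<in>V. \<Sum>v\<in>V. om u v * (g u - g v)\<^sup>2)"
      by (intro sum_mono mult_left_mono om_nonneg)
    then show ?thesis by (simp add: energy_def sum.distrib distrib_left)
  qed
  moreover have "\<mu> \<ge> 0"
    using order.trans[OF energy_nonneg small] pos by (simp add: zero_le_mult_iff)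
  ultimately have "energy p + energy q \<le> \<mu> * (mass p + mass q)"
    using small mult_left_mono[OF mass_ge, of \<mu>] by linarith
  then have "energy p + energy q \<le> \<mu> * mass p + \<mu> * mass q"
    by (simp only: distrib_left)
  moreover have "mass p > 0 \<or> mass q > 0"
    using mass_ge pos by linarith
  moreover have "\<mu> * mass f < energy f \<or> mass f = 0 \<or> (mass f > 0 \<and> energy f \<le> \<mu> * mass f)" for f
    using mass_nonneg[of f] by (auto simp: not_less order.order_iff_strict)
  moreover have "\<mu> * mass f \<le> energy f" if "mass f = 0" for f
    using that energy_nonneg by simp
  ultimately have "(mass p > 0 \<and> energy p \<le> \<mu> * mass p) \<or> (mass q > 0 \<and> energy q \<le> \<mu> * mass q)"
    by (smt (verit))
  then obtain f where f: "mass f > 0" "energy f \<le> \<mu> * mass f"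
    "(h * mass f)\<^sup>2 \<le> energy f * (2 * c * mass f - energy f)"
    using parts by blast
  define x where "x = energy f / mass f"
  have E: "energy f = x * mass f" using f by (simp add: x_def)
  have x: "x \<le> \<mu>" using f by (simp add: x_def divide_simps)
  have "h\<^sup>2 * (mass f)\<^sup>2 \<le> x * (2 * c - x) * (mass f)\<^sup>2"
    using f(3) unfolding E by (simp add: power2_eq_square algebra_simps)
  then have "h\<^sup>2 \<le> x * (2 * c - x)" using f(1) by simp
  also have "\<dots> \<le> \<mu> * (2 * c - \<mu>)"
  proof -
    \<comment> \<open>The parabola \<open>x (2 c - x)\<close> increases up to \<open>x = c\<close>.\<close>
    have "(\<mu> - x) * (2 * c - \<mu> - x) \<ge> 0" using x \<open>\<mu> \<le> c\<close> by simp
    then show ?thesis by (simp add: algebra_simps)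
  qed
  finally show ?thesis .
qed

end

section \<open>Energies of functions along paths and the ground state transform\<close>

lemma doubleton_path_edge_inj:
  assumes "distinct xs"
  shows "inj_on (\<lambda>i. {xs ! i, xs ! Suc i}) {..<length xs - 1}"
proof (rule inj_onI)
  fix i j assume ij: "i \<in> {..<length xs - 1}" "j \<in> {..<length xs - 1}"
    and eq: "{xs ! i, xs ! Suc i} = {xs ! j, xs ! Suc j}"
  have bounds: "i < length xs" "Suc i < length xs" "j < length xs" "Suc j < length xs"
    using ij by auto
  from eq have "(xs ! i = xs ! j \<and> xs ! Suc i = xs ! Suc j) \<or> (xs ! i = xs ! Suc j \<and> xs ! Suc i = xs ! j)"
    by (simp add: doubleton_eq_iff)
  then show "i = j"
    using nth_eq_iff_index_eq[OF assms] bounds by auto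
qed

lemma path_edges_image: "path_edges xs = (\<lambda>i. {xs ! i, xs ! Suc i}) ` {..<length xs - 1}"
  by (auto simp: path_edges_def less_diff_conv)

text \<open>Telescope \<open>g x - g y\<close> along the path and apply the Cauchy--Schwarz inequality; this is where the
  factor \<open>\<ell>\<^sub>p\<close> in \<open>omega\<close> comes from. The factor 2 accounts for the sum over ordered pairs on the right, in
  which a path edge occurs in both orientations.\<close>

lemma path_dirichlet_bound:
  fixes g :: "nat \<Rightarrow> real"
  assumes "p \<in> paths F x y" and V: "finite V" "\<Union>p \<subseteq> V"
  shows "2 * (g x - g y)\<^sup>2 \<le>
    real (card p) * (\<Sum>z\<in>V \<times> V. of_bool ({fst z, snd z} \<in> p) * (g (fst z) - g (snd z))\<^sup>2)"
proof -
  from assms(1) obtain xs where xs: "p = path_edges xs" "xs \<noteq> []" "hd xs = x" "last xs = y" "distinct xs"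
    by (auto simp: paths_def)
  define L where "L = length xs - 1"
  define a where "a i = xs ! i" for i
  define D where "D i = g (a (Suc i)) - g (a i)" for i
  \<comment> \<open>The two orientations of the \<open>i\<close>-th edge of the path.\<close>
  define fwd where "fwd i = (a i, a (Suc i))" for i
  define bwd where "bwd i = (a (Suc i), a i)" for i
  have p: "p = (\<lambda>i. {a i, a (Suc i)}) ` {..<L}"
    by (simp add: xs(1) path_edges_image a_def L_def)
  have card_p: "card p = L"
    unfolding p using doubleton_path_edge_inj[OF xs(5)] by (simp add: card_image a_def L_def)
  have a_eq: "a i = a j \<longleftrightarrow> i = j" if "i \<le> L" "j \<le> L" for i j
  proof -
    have "length xs > 0" using xs(2) by simp
    then have "i < length xs" "j < length xs" using that unfolding L_def by linarith+
    then show ?thesis unfolding a_def by (simp add: nth_eq_iff_index_eq[OF xs(5)])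
  qed
  have ends: "a 0 = x" "a L = y"
    using xs by (simp_all add: a_def L_def hd_conv_nth last_conv_nth)
  have "g y - g x = (\<Sum>i<L. D i * 1)"
    unfolding D_def mult_1_right using sum_lessThan_telescope[of "\<lambda>i. g (a i)" L] by (simp add: ends)
  then have "(g x - g y)\<^sup>2 = (\<Sum>i<L. D i * 1)\<^sup>2" by (simp add: power2_commute[of "g x"])
  also have "\<dots> \<le> (\<Sum>i<L. (D i)\<^sup>2) * (\<Sum>i<L. 1\<^sup>2)"
    by (rule Cauchy_Schwarz_ineq_sum)
  finally have cs: "(g x - g y)\<^sup>2 \<le> real (card p) * (\<Sum>i<L. (D i)\<^sup>2)"
    by (simp add: card_p mult.commute)
  have inj: "inj_on fwd {..<L}" "inj_on bwd {..<L}"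
    by (auto simp: inj_on_def fwd_def bwd_def a_eq)
  let ?d = "\<lambda>z. of_bool ({fst z, snd z} \<in> p) * (g (fst z) - g (snd z))\<^sup>2"
  have mem: "{a i, a (Suc i)} \<in> p" if "i < L" for i using that by (auto simp: p)
  have d: "?d (fwd i) = (D i)\<^sup>2" "?d (bwd i) = (D i)\<^sup>2" if "i < L" for i
    using mem[OF that] by (simp_all add: fwd_def bwd_def D_def insert_commute power2_commute)
  have disj: "fwd ` {..<L} \<inter> bwd ` {..<L} = {}"
    by (auto simp: fwd_def bwd_def a_eq)
  have sub: "fwd ` {..<L} \<union> bwd ` {..<L} \<subseteq> V \<times> V"
    using mem V(2) by (force simp: fwd_def bwd_def)
  have "2 * (\<Sum>i<L. (D i)\<^sup>2) = (\<Sum>z\<in>fwd ` {..<L}. ?d z) + (\<Sum>z\<in>bwd ` {..<L}. ?d z)"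
    using d by (simp add: sum.reindex[OF inj(1)] sum.reindex[OF inj(2)] del: of_bool_eq_1_iff)
  also have "\<dots> = (\<Sum>z\<in>fwd ` {..<L} \<union> bwd ` {..<L}. ?d z)"
    using disj by (intro sum.union_disjoint[symmetric]) auto
  also have "\<dots> \<le> (\<Sum>z\<in>V \<times> V. ?d z)"
    using sub V(1) by (intro sum_mono2) auto
  finally have "real (card p) * (2 * (\<Sum>i<L. (D i)\<^sup>2)) \<le> real (card p) * (\<Sum>z\<in>V \<times> V. ?d z)"
    by (rule mult_left_mono) simp
  with cs show ?thesis by linarith
qed

lemma symmetric_double_sum:
  fixes K :: "nat \<Rightarrow> nat \<Rightarrow> real"
  assumes "\<And>u v. K u v = K v u" and "\<And>u. K u u = 0"
  shows "(\<Sum>z\<in>{..<n} \<times> {..<n}. K (fst z) (snd z)) =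
         2 * (\<Sum>z\<in>{(x, y). x < y \<and> y < n}. K (fst z) (snd z))"
proof -
  let ?U = "{(x, y). x < y \<and> y < n}" and ?L = "{(x, y). y < x \<and> x < n}" and ?D = "{(x, y). x = y \<and> y < n}"
  have fin: "finite ?U" "finite ?L" "finite ?D"
    by (rule finite_subset[of _ "{..<n} \<times> {..<n}"]; auto)+
  have "{..<n} \<times> {..<n} = (?U \<union> ?L) \<union> ?D" by auto
  then have "(\<Sum>z\<in>{..<n} \<times> {..<n}. K (fst z) (snd z)) =
      (\<Sum>z\<in>(?U \<union> ?L) \<union> ?D. K (fst z) (snd z))" by (rule arg_cong)
  also have "\<dots> = (\<Sum>z\<in>?U \<union> ?L. K (fst z) (snd z)) + (\<Sum>z\<in>?D. K (fst z) (snd z))"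
    using fin by (intro sum.union_disjoint) auto
  also have "(\<Sum>z\<in>?U \<union> ?L. K (fst z) (snd z)) =
      (\<Sum>z\<in>?U. K (fst z) (snd z)) + (\<Sum>z\<in>?L. K (fst z) (snd z))"
    using fin by (intro sum.union_disjoint) auto
  also have "(\<Sum>z\<in>?D. K (fst z) (snd z)) = 0"
    using assms(2) by (intro sum.neutral) auto
  also have "(\<Sum>z\<in>?L. K (fst z) (snd z)) = (\<Sum>z\<in>?U. K (fst z) (snd z))"
    using assms(1) by (intro sum.reindex_bij_witness[of _ prod.swap prod.swap]) auto
  finally show ?thesis by simp
qed

text \<open>Expand the square: by the eigenvalue equation for \<open>\<phi>\<close>, the terms with \<open>(g u)\<^sup>2\<close> and \<open>(g v)\<^sup>2\<close> each
  sum to \<open>l\<close> times the squared norm of \<open>f = \<phi> g\<close>, and the mixed terms give the quadratic form. The diagonal of the matrix drops out,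
  and with it the potential.\<close>

lemma ground_state_transform:
  assumes sym: "\<And>u v. u < n \<Longrightarrow> v < n \<Longrightarrow> M u v = M v u"
    and ev: "\<And>u. u < n \<Longrightarrow> dot n (M u) \<phi> = l * \<phi> u"
    and f: "\<And>u. u < n \<Longrightarrow> f u = \<phi> u * g u"
  shows "dot n f (\<lambda>u. dot n (M u) f) - l * dot n f f =
    - (\<Sum>z\<in>{..<n} \<times> {..<n}. M (fst z) (snd z) * \<phi> (fst z) * \<phi> (snd z) * (g (fst z) - g (snd z))\<^sup>2) / 2"
proof -
  let ?S = "\<lambda>F. (\<Sum>u<n. \<Sum>v<n. F u v :: real)"
  have row: "?S (\<lambda>u v. M u v * \<phi> u * \<phi> v * (g u)\<^sup>2) = l * dot n f f"
  proof -
    have "?S (\<lambda>u v. M u v * \<phi> u * \<phi> v * (g u)\<^sup>2) = (\<Sum>u<n. \<phi> u * (g u)\<^sup>2 * dot n (M u) \<phi>)"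
      by (simp add: dot_def sum_distrib_left algebra_simps)
    also have "\<dots> = (\<Sum>u<n. l * (f u * f u))"
      by (intro sum.cong) (auto simp: ev f power2_eq_square)
    finally show ?thesis by (simp add: dot_def sum_distrib_left)
  qed
  have col: "?S (\<lambda>u v. M u v * \<phi> u * \<phi> v * (g v)\<^sup>2) = ?S (\<lambda>u v. M u v * \<phi> u * \<phi> v * (g u)\<^sup>2)"
    by (subst sum.swap, intro sum.cong refl) (use sym in auto)
  have mixed: "?S (\<lambda>u v. M u v * \<phi> u * \<phi> v * (g u * g v)) = dot n f (\<lambda>u. dot n (M u) f)"
    unfolding dot_def sum_distrib_left by (intro sum.cong refl) (simp add: f)
  have "(\<Sum>z\<in>{..<n} \<times> {..<n}. M (fst z) (snd z) * \<phi> (fst z) * \<phi> (snd z) * (g (fst z) - g (snd z))\<^sup>2) =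
      ?S (\<lambda>u v. M u v * \<phi> u * \<phi> v * (g u - g v)\<^sup>2)"
    by (simp add: sum.cartesian_product split_def)
  also have "\<dots> = ?S (\<lambda>u v. M u v * \<phi> u * \<phi> v * (g u)\<^sup>2 + M u v * \<phi> u * \<phi> v * (g v)\<^sup>2
      - 2 * (M u v * \<phi> u * \<phi> v * (g u * g v)))"
    by (intro sum.cong refl) (simp add: power2_eq_square algebra_simps)
  also have "\<dots> = 2 * (l * dot n f f) - 2 * dot n f (\<lambda>u. dot n (M u) f)"
    by (simp add: sum.distrib sum_subtractf sum_distrib_left[symmetric] row col mixed)
  finally show ?thesis by simp
qed

section \<open>Replacing negative edges by routed positive weights\<close>

locale signed_graph =
  fixes n :: nat and E :: "nat set set" and w :: "nat \<Rightarrow> nat \<Rightarrow> real"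
  assumes graph: "weighted_graph n E w"
begin

lemma w_sym: "w u v = w v u"
  using graph by (simp add: weighted_graph_def)

lemma w_support: "w u v \<noteq> 0 \<Longrightarrow> u < n \<and> v < n \<and> u \<noteq> v \<and> {u, v} \<in> E"
  using graph unfolding weighted_graph_def by (fastforce simp: doubleton_eq_iff)

lemma w_diag: "w u u = 0"
  using w_support by blast

lemma pos_edges_iff: "{u, v} \<in> pos_edges E w \<longleftrightarrow> w u v > 0"
proof
  assume "{u, v} \<in> pos_edges E w"
  then obtain x y where "{u, v} = {x, y}" "w x y > 0" by (auto simp: pos_edges_def)
  then show "w u v > 0" using w_sym[of x y] by (auto simp: doubleton_eq_iff)
next
  assume "w u v > 0"
  then show "{u, v} \<in> pos_edges E w" using w_support[of u v] by (auto simp: pos_edges_def)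
qed

lemma Union_pos_edges: "\<Union>(pos_edges E w) \<subseteq> {..<n}"
proof -
  have "u < n \<and> v < n" if "w u v > 0" for u v using w_support[of u v] that by auto
  then show ?thesis by (auto simp: pos_edges_def)
qed

lemma finite_paths: "finite (paths (pos_edges E w) x y)"
proof -
  have "finite (pos_edges E w)"
    using Union_pos_edges by (meson finite_UnionD finite_lessThan finite_subset)
  then show ?thesis
    by (rule finite_subset[rotated, OF iffD2[OF finite_Pow_iff]]) (auto simp: paths_def)
qed

lemma path_subset: "p \<in> paths (pos_edges E w) x y \<Longrightarrow> p \<subseteq> pos_edges E w"
  by (auto simp: paths_def)

lemma pos_degree_nonneg: "pos_degree n E w u \<ge> 0"
  unfolding pos_degree_def by (rule sum_nonneg) (simp add: pos_edges_iff)

text \<open>The conductances to which Cheeger's inequality is applied: the weights \<open>\<omega>\<close>, set to 0 on pairs that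
  are not positive edges.\<close>

definition routed_weight :: "real vec \<Rightarrow> (nat set set \<Rightarrow> real) \<Rightarrow> nat \<Rightarrow> nat \<Rightarrow> real" where
  "routed_weight \<phi> \<alpha> u v = of_bool ({u, v} \<in> pos_edges E w) * omega n E w \<phi> \<alpha> u v"

lemma routed_weight_sym: "routed_weight \<phi> \<alpha> u v = routed_weight \<phi> \<alpha> v u"
  unfolding routed_weight_def omega_def by (simp add: insert_commute w_sym[of u v] mult.commute mult.left_commute)

lemma routed_weight_nonneg: "admissible n E w \<phi> \<alpha> \<Longrightarrow> routed_weight \<phi> \<alpha> u v \<ge> 0"
  by (auto simp: routed_weight_def admissible_def intro: less_imp_le)

text \<open>A negative edge lowers the energy by \<open>\<bar>w\<^sub>x\<^sub>y\<bar> \<phi>(x) \<phi>(y) (g x - g y)\<^sup>2\<close>. Splitting this amount over the paths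
  from \<open>x\<close> to \<open>y\<close> according to \<open>\<alpha>\<close>, the path bound charges it to the positive edges, and the total charge on
  an edge is what \<open>omega\<close> subtracts from its weight.\<close>

lemma routed_energy_le:
  fixes g :: "nat \<Rightarrow> real"
  assumes rt: "routing E w \<alpha>" and \<phi>: "\<And>u. u < n \<Longrightarrow> \<phi> $ u \<ge> 0"
  shows "(\<Sum>z\<in>{..<n} \<times> {..<n}. routed_weight \<phi> \<alpha> (fst z) (snd z) * (g (fst z) - g (snd z))\<^sup>2)
    \<le> (\<Sum>z\<in>{..<n} \<times> {..<n}. w (fst z) (snd z) * \<phi> $ fst z * \<phi> $ snd z * (g (fst z) - g (snd z))\<^sup>2)"
proof -
  let ?V2 = "{..<n} \<times> {..<n}"
  define d where "d z = (g (fst z) - g (snd z))\<^sup>2" for z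
  define b where "b z = w (fst z) (snd z) * \<phi> $ fst z * \<phi> $ snd z" for z
  define P where "P e = paths (pos_edges E w) (fst e) (snd e)" for e
  define N where "N = {(x, y). x < y \<and> y < n \<and> {x, y} \<in> E \<and> w x y < 0}"
  define in_path :: "nat \<times> nat \<Rightarrow> nat set set \<Rightarrow> real" where "in_path z p = of_bool ({fst z, snd z} \<in> p)" for z p
  define pos :: "nat \<times> nat \<Rightarrow> real" where "pos z = of_bool ({fst z, snd z} \<in> pos_edges E w)" for z
  have finN: "finite N"
    by (rule finite_subset[of _ ?V2]) (auto simp: N_def)
  have finP: "finite (P e)" for e by (simp add: P_def finite_paths)
  \<comment> \<open>For a negative edge \<open>e\<close>, \<open>- b e\<close> is the nonnegative quantity \<open>\<bar>w\<^sub>x\<^sub>y\<bar> \<phi>(x) \<phi>(y)\<close>.\<close>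
  have omega: "omega n E w \<phi> \<alpha> (fst z) (snd z) =
      b z - (\<Sum>e\<in>N. \<Sum>p\<in>P e. - b e * (real (card p) * \<alpha> p * in_path z p))" for z
  proof -
    have "(\<Sum>p\<in>{p \<in> P e. {fst z, snd z} \<in> p}. \<bar>w (fst e) (snd e)\<bar> * real (card p) * \<alpha> p * \<phi> $ fst e * \<phi> $ snd e)
        = (\<Sum>p\<in>P e. - b e * (real (card p) * \<alpha> p * in_path z p))" if "e \<in> N" for e
      unfolding sum.inter_filter[OF finP]
      by (rule sum.cong) (use that in \<open>auto simp: N_def b_def in_path_def algebra_simps\<close>)
    then show ?thesis
      unfolding omega_def N_def[symmetric] by (simp add: split_def P_def b_def cong: sum.cong)
  qed
  have pos_path: "pos z * in_path z p = in_path z p" if "p \<in> P e" for z p e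
    using path_subset that by (auto simp: pos_def in_path_def P_def)
  have summand: "routed_weight \<phi> \<alpha> (fst z) (snd z) * d z =
      pos z * b z * d z - (\<Sum>e\<in>N. \<Sum>p\<in>P e. - b e * (real (card p) * \<alpha> p) * (in_path z p * d z))" for z
  proof -
    have "routed_weight \<phi> \<alpha> (fst z) (snd z) * d z =
        pos z * b z * d z - (\<Sum>e\<in>N. \<Sum>p\<in>P e. - b e * (real (card p) * \<alpha> p) * ((pos z * in_path z p) * d z))"
      unfolding routed_weight_def omega pos_def[symmetric]
      by (simp add: sum_distrib_left sum_distrib_right algebra_simps)
    then show ?thesis using pos_path by (simp cong: sum.cong)
  qed
  have routed: "- b e * (2 * d e) \<le>
      (\<Sum>p\<in>P e. - b e * (real (card p) * \<alpha> p) * (\<Sum>z\<in>?V2. in_path z p * d z))" if e: "e \<in> N" for e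
  proof -
    obtain x y where xy: "e = (x, y)" by (cases e)
    have E: "{x, y} \<in> E" "x < n" "y < n" "w x y < 0" using e by (auto simp: N_def xy)
    then have b: "- b e \<ge> 0"
      using \<phi>[of x] \<phi>[of y] by (simp add: b_def xy mult_nonpos_nonneg)
    have \<alpha>: "(\<Sum>p\<in>P e. \<alpha> p) = 1" "\<And>p. p \<in> P e \<Longrightarrow> \<alpha> p \<ge> 0"
      using rt E(1) unfolding routing_def by (auto simp: P_def xy)
    have "- b e * (2 * d e) = (\<Sum>p\<in>P e. (- b e * \<alpha> p) * (2 * d e))"
      using \<alpha>(1) by (simp add: sum_distrib_right[symmetric] sum_distrib_left[symmetric] del: mult_minus_left)
    also have "\<dots> \<le> (\<Sum>p\<in>P e. (- b e * \<alpha> p) * (real (card p) * (\<Sum>z\<in>?V2. in_path z p * d z)))"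
    proof (intro sum_mono mult_left_mono)
      fix p assume p: "p \<in> P e"
      then have "\<Union>p \<subseteq> {..<n}" using path_subset Union_pos_edges by (fastforce simp: P_def)
      with p show "2 * d e \<le> real (card p) * (\<Sum>z\<in>?V2. in_path z p * d z)"
        unfolding d_def in_path_def by (intro path_dirichlet_bound) (auto simp: P_def)
      show "0 \<le> - b e * \<alpha> p" using b \<alpha>(2)[OF p] by (rule mult_nonneg_nonneg)
    qed
    finally show ?thesis by (simp add: mult.assoc mult.left_commute)
  qed
  \<comment> \<open>The left side counts every negative edge in both orientations, the set \<open>N\<close> only once.\<close>
  have neg: "(\<Sum>z\<in>?V2. of_bool (w (fst z) (snd z) < 0) * (b z * d z)) = 2 * (\<Sum>e\<in>N. b e * d e)"
  proof -
    define K where "K u v = of_bool (w u v < 0) * (b (u, v) * d (u, v))" for u v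
    have "K u v = K v u" for u v
      by (simp add: K_def b_def d_def w_sym[of u v] power2_commute[of "g u"])
    moreover have "K u u = 0" for u by (simp add: K_def d_def)
    ultimately have "(\<Sum>z\<in>?V2. K (fst z) (snd z)) = 2 * (\<Sum>z\<in>{(x, y). x < y \<and> y < n}. K (fst z) (snd z))"
      by (rule symmetric_double_sum)
    also have "(\<Sum>z\<in>{(x, y). x < y \<and> y < n}. K (fst z) (snd z)) = (\<Sum>e\<in>N. b e * d e)"
    proof (rule sum.mono_neutral_cong_right)
      show "finite {(x, y). x < y \<and> y < n}"
        by (rule finite_subset[of _ ?V2]) auto
      show "\<forall>z\<in>{(x, y). x < y \<and> y < n} - N. K (fst z) (snd z) = 0"
        using w_support by (force simp: N_def K_def)
    qed (auto simp: N_def K_def)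
    finally show ?thesis by (simp add: K_def)
  qed
  have "(\<Sum>z\<in>?V2. routed_weight \<phi> \<alpha> (fst z) (snd z) * d z) =
      (\<Sum>z\<in>?V2. pos z * b z * d z) -
      (\<Sum>z\<in>?V2. \<Sum>e\<in>N. \<Sum>p\<in>P e. - b e * (real (card p) * \<alpha> p) * (in_path z p * d z))"
    by (simp only: summand sum_subtractf)
  also have "(\<Sum>z\<in>?V2. \<Sum>e\<in>N. \<Sum>p\<in>P e. - b e * (real (card p) * \<alpha> p) * (in_path z p * d z)) =
      (\<Sum>e\<in>N. \<Sum>z\<in>?V2. \<Sum>p\<in>P e. - b e * (real (card p) * \<alpha> p) * (in_path z p * d z))"
    by (rule sum.swap)
  also have "\<dots> = (\<Sum>e\<in>N. \<Sum>p\<in>P e. \<Sum>z\<in>?V2. - b e * (real (card p) * \<alpha> p) * (in_path z p * d z))"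
    by (rule sum.cong[OF refl], rule sum.swap)
  also have "\<dots> = (\<Sum>e\<in>N. \<Sum>p\<in>P e. - b e * (real (card p) * \<alpha> p) * (\<Sum>z\<in>?V2. in_path z p * d z))"
    by (simp only: sum_distrib_left)
  also have "(\<Sum>z\<in>?V2. pos z * b z * d z) - \<dots> \<le> (\<Sum>z\<in>?V2. pos z * b z * d z) - (\<Sum>e\<in>N. - b e * (2 * d e))"
    using routed by (intro diff_left_mono sum_mono) auto
  also have "\<dots> = (\<Sum>z\<in>?V2. pos z * b z * d z) + (\<Sum>z\<in>?V2. of_bool (w (fst z) (snd z) < 0) * (b z * d z))"
    unfolding neg by (simp add: sum_negf sum_distrib_left algebra_simps)
  also have "\<dots> = (\<Sum>z\<in>?V2. pos z * b z * d z + of_bool (w (fst z) (snd z) < 0) * (b z * d z))"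
    by (rule sum.distrib[symmetric])
  also have "\<dots> = (\<Sum>z\<in>?V2. b z * d z)"
  proof (rule sum.cong[OF refl])
    fix z
    show "pos z * b z * d z + of_bool (w (fst z) (snd z) < 0) * (b z * d z) = b z * d z"
      by (cases "w (fst z) (snd z)" "0 :: real" rule: linorder_cases)
         (simp_all add: pos_def pos_edges_iff b_def)
  qed
  finally show ?thesis by (simp add: d_def b_def)
qed

lemma omega_le:
  assumes rt: "routing E w \<alpha>" and \<phi>: "\<And>u. u < n \<Longrightarrow> \<phi> $ u \<ge> 0"
  shows "omega n E w \<phi> \<alpha> u v \<le> w u v * \<phi> $ u * \<phi> $ v"
proof -
  have "0 \<le> (\<Sum>(x, y) \<in> {(x, y). x < y \<and> y < n \<and> {x, y} \<in> E \<and> w x y < 0}.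
        \<Sum>p \<in> {p \<in> paths (pos_edges E w) x y. {u, v} \<in> p}.
          \<bar>w x y\<bar> * real (card p) * \<alpha> p * \<phi> $ x * \<phi> $ y)"
  proof (rule sum_nonneg, clarify, rule sum_nonneg, clarify)
    fix x y p
    assume "x < y" "y < n" "{x, y} \<in> E" "p \<in> paths (pos_edges E w) x y"
    then have "\<alpha> p \<ge> 0" "\<phi> $ x \<ge> 0" "\<phi> $ y \<ge> 0"
      using rt \<phi> by (auto simp: routing_def)
    then show "0 \<le> \<bar>w x y\<bar> * real (card p) * \<alpha> p * \<phi> $ x * \<phi> $ y" by simp
  qed
  then show ?thesis by (simp add: omega_def)
qed

text \<open>A zero of \<open>\<phi>\<close> at \<open>u\<close> would make \<open>omega\<close> nonpositive on any positive edge at \<open>u\<close>, and such an edge exists by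
  connectedness.\<close>

lemma ground_state_pos:
  assumes "n \<ge> 2" and conn: "connected_graph n (pos_edges E w)"
    and adm: "admissible n E w \<phi> \<alpha>" and \<phi>: "\<And>u. u < n \<Longrightarrow> \<phi> $ u \<ge> 0" and u: "u < n"
  shows "\<phi> $ u > 0"
proof -
  define v :: nat where "v = (if u = 0 then 1 else 0)"
  have v: "v < n" "v \<noteq> u" using \<open>n \<ge> 2\<close> by (auto simp: v_def)
  with conn u have "paths (pos_edges E w) u v \<noteq> {}" by (simp add: connected_graph_def)
  then obtain xs where xs: "xs \<noteq> []" "hd xs = u" "last xs = v" "path_edges xs \<subseteq> pos_edges E w"
    by (auto simp: paths_def)
  then obtain ys where ys: "xs = u # ys" by (metis list.collapse)
  then have "ys \<noteq> []" using xs v by auto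
  then have "{xs ! 0, xs ! Suc 0} \<in> path_edges xs"
    unfolding path_edges_def using ys by (intro CollectI exI[of _ 0]) simp
  then have "{u, xs ! 1} \<in> pos_edges E w" using xs(4) ys by auto
  then have "0 < omega n E w \<phi> \<alpha> u (xs ! 1)" using adm by (simp add: admissible_def)
  also have "\<dots> \<le> w u (xs ! 1) * \<phi> $ u * \<phi> $ (xs ! 1)"
    using adm \<phi> by (intro omega_le) (auto simp: admissible_def)
  finally have "\<phi> $ u \<noteq> 0" by auto
  with \<phi>[OF u] show ?thesis by simp
qed

lemma cut_weight_routed:
  assumes "S \<subseteq> {..<n}"
  shows "cut_weight n E w \<phi> \<alpha> S = (\<Sum>u\<in>S. \<Sum>v\<in>{..<n} - S. routed_weight \<phi> \<alpha> u v)"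
proof -
  have fin: "finite (S \<times> ({..<n} - S))" using assms finite_subset by blast
  have "(\<Sum>u\<in>S. \<Sum>v\<in>{..<n} - S. routed_weight \<phi> \<alpha> u v) =
      (\<Sum>z\<in>S \<times> ({..<n} - S). routed_weight \<phi> \<alpha> (fst z) (snd z))"
    by (simp add: sum.cartesian_product split_def)
  also have "\<dots> = cut_weight n E w \<phi> \<alpha> S"
    unfolding cut_weight_def using fin
    by (intro sum.mono_neutral_cong_right) (auto simp: routed_weight_def)
  finally show ?thesis by simp
qed

lemma cut_weight_nonneg:
  "admissible n E w \<phi> \<alpha> \<Longrightarrow> S \<subseteq> {..<n} \<Longrightarrow> cut_weight n E w \<phi> \<alpha> S \<ge> 0"
  by (simp add: cut_weight_routed sum_nonneg routed_weight_nonneg)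

lemma finite_cuts: "finite {S. S \<noteq> {} \<and> S \<subset> {..<n}}"
  by (rule finite_subset[of _ "Pow {..<n}"]) auto

lemma h_routing_nonneg:
  assumes "n \<ge> 2" and adm: "admissible n E w \<phi> \<alpha>"
  shows "h_routing n E w \<phi> \<alpha> \<ge> 0"
proof -
  have "1 \<in> {..<n}" using \<open>n \<ge> 2\<close> by simp
  then have "{..<n} \<noteq> {0}" by (metis one_neq_zero singletonD)
  moreover have "{0} \<subseteq> {..<n}" using \<open>n \<ge> 2\<close> by simp
  ultimately have "{0} \<in> {S. S \<noteq> {} \<and> S \<subset> {..<n}}" by blast
  then have ne: "{S. S \<noteq> {} \<and> S \<subset> {..<n}} \<noteq> {}" by blast
  have "0 \<le> (MAX S' \<in> {S, {..<n} - S}. cut_weight n E w \<phi> \<alpha> S / (\<Sum>u\<in>S'. (\<phi> $ u)\<^sup>2))"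
    if "S \<subset> {..<n}" for S
  proof -
    have "0 \<le> cut_weight n E w \<phi> \<alpha> S / (\<Sum>u\<in>S. (\<phi> $ u)\<^sup>2)"
      using that cut_weight_nonneg[OF adm, of S] by (simp add: sum_nonneg less_imp_le)
    then show ?thesis by (simp add: Max_ge_iff)
  qed
  then show ?thesis
    unfolding h_routing_def using finite_cuts ne by (subst Min_ge_iff) auto
qed

text \<open>For a set of at most half the measure, the maximum over the set and its complement is attained
  at the set itself.\<close>

lemma h_routing_isoperimetry:
  assumes adm: "admissible n E w \<phi> \<alpha>" and pos: "\<And>u. u < n \<Longrightarrow> \<phi> $ u > 0"
    and S: "S \<noteq> {}" "S \<subseteq> {..<n}"
    and half: "2 * (\<Sum>u\<in>S. (\<phi> $ u)\<^sup>2) \<le> (\<Sum>u<n. (\<phi> $ u)\<^sup>2)"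
  shows "h_routing n E w \<phi> \<alpha> * (\<Sum>u\<in>S. (\<phi> $ u)\<^sup>2) \<le> (\<Sum>u\<in>S. \<Sum>v\<in>{..<n} - S. routed_weight \<phi> \<alpha> u v)"
proof -
  define m where "m A = (\<Sum>u\<in>A. (\<phi> $ u)\<^sup>2)" for A
  define C where "C = cut_weight n E w \<phi> \<alpha> S"
  have finS: "finite S" using S finite_subset by blast
  have mS: "m S > 0"
    unfolding m_def using finS S(1)
  proof (rule sum_pos)
    fix u assume "u \<in> S"
    then show "0 < (\<phi> $ u)\<^sup>2" using pos[of u] S(2) by auto
  qed
  have split: "m {..<n} = m ({..<n} - S) + m S"
    unfolding m_def using S by (intro sum.subset_diff) auto
  have le: "m S \<le> m ({..<n} - S)" using half split by (simp add: m_def)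
  have "{..<n} - S \<noteq> {}"
  proof
    assume "{..<n} - S = {}"
    then have "m ({..<n} - S) = 0" by (simp only: m_def sum.empty)
    with le mS show False by linarith
  qed
  then have "S \<in> {S. S \<noteq> {} \<and> S \<subset> {..<n}}" using S by blast
  then have "h_routing n E w \<phi> \<alpha> \<le> (MAX S' \<in> {S, {..<n} - S}. C / m S')"
    unfolding h_routing_def C_def m_def using finite_cuts by (intro Min_le) auto
  also have "\<dots> \<le> C / m S"
    using cut_weight_nonneg[OF adm S(2)] mS le by (auto simp: C_def intro!: divide_left_mono)
  finally show ?thesis
    using mS by (simp add: pos_le_divide_eq C_def m_def cut_weight_routed[OF S(2)])
qed

section \<open>The spectral gap\<close>

text \<open>The function \<open>g = f / \<phi>\<close>, where \<open>f\<close> is a test vector orthogonal to \<open>\<phi>\<close>, is fed into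
  Cheeger's inequality for the measure \<open>\<phi>\<^sup>2\<close>; the energy comparison bounds its Rayleigh quotient by the gap.
  The degree bound that Cheeger's inequality requires comes from the same energy comparison, applied
  to the indicator function of a single vertex \<open>z\<close>: its energy is the degree of \<open>z\<close>, and the quadratic form of
  \<open>H - \<lambda>\<^sub>0\<close> at the corresponding vector is \<open>(H\<^sub>z\<^sub>z - \<lambda>\<^sub>0) \<phi>(z)\<^sup>2\<close>, where the diagonal entry is at most the largest eigenvalue.\<close>

lemma routing_cheeger:
  assumes n: "n \<ge> 2" and H: "H \<in> carrier_mat n n"
    and off: "\<And>u v. u < n \<Longrightarrow> v < n \<Longrightarrow> u \<noteq> v \<Longrightarrow> H $$ (u, v) = - w u v"
    and lam: "sorted_eigenvalues n H lam"
    and ev: "\<And>u. u < n \<Longrightarrow> dot n (\<lambda>v. H $$ (u, v)) (\<lambda>v. \<phi> $ v) = lam 0 * \<phi> $ u"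
    and pos: "\<And>u. u < n \<Longrightarrow> \<phi> $ u > 0"
    and adm: "admissible n E w \<phi> \<alpha>"
  shows "(h_routing n E w \<phi> \<alpha>)\<^sup>2 \<le> (lam 1 - lam 0) * (2 * (lam (n - 1) - lam 0) - (lam 1 - lam 0))"
proof -
  let ?R = "routed_weight \<phi> \<alpha>" and ?V2 = "{..<n} \<times> {..<n}"
  let ?M = "\<lambda>u v. H $$ (u, v)"
  have M_sym: "?M u v = ?M v u" if "u < n" "v < n" for u v
    using off[of u v] off[of v u] that w_sym by (cases "u = v") auto
  then have sym: "transpose_mat H = H" using H by (intro eq_matI) auto
  have cp: "char_poly H = (\<Prod>i<n. [:- lam i, 1:])" and mono: "\<And>i j. i \<le> j \<Longrightarrow> j < n \<Longrightarrow> lam i \<le> lam j"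
    using lam by (auto simp: sorted_eigenvalues_def)
  have energy_le: "(\<Sum>z\<in>?V2. ?R (fst z) (snd z) * (g (fst z) - g (snd z))\<^sup>2) / 2
      \<le> dot n f (\<lambda>u. dot n (?M u) f) - lam 0 * dot n f f"
    if f: "\<And>u. u < n \<Longrightarrow> f u = \<phi> $ u * g u" for f g
  proof -
    have "(\<Sum>z\<in>?V2. ?R (fst z) (snd z) * (g (fst z) - g (snd z))\<^sup>2)
        \<le> (\<Sum>z\<in>?V2. w (fst z) (snd z) * \<phi> $ fst z * \<phi> $ snd z * (g (fst z) - g (snd z))\<^sup>2)"
      using adm pos by (intro routed_energy_le) (auto simp: admissible_def intro: less_imp_le)
    also have "\<dots> = (\<Sum>z\<in>?V2. - (?M (fst z) (snd z) * \<phi> $ fst z * \<phi> $ snd z * (g (fst z) - g (snd z))\<^sup>2))"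
    proof (rule sum.cong[OF refl])
      fix z assume z: "z \<in> ?V2"
      show "w (fst z) (snd z) * \<phi> $ fst z * \<phi> $ snd z * (g (fst z) - g (snd z))\<^sup>2 =
          - (?M (fst z) (snd z) * \<phi> $ fst z * \<phi> $ snd z * (g (fst z) - g (snd z))\<^sup>2)"
        using z off[of "fst z" "snd z"] by (cases "fst z = snd z") auto
    qed
    finally show ?thesis
      using ground_state_transform[of n ?M "\<lambda>v. \<phi> $ v" "lam 0" f g, OF M_sym ev f]
      by (simp add: sum_negf)
  qed
  have degree: "(\<Sum>v<n. ?R z v) \<le> (lam (n - 1) - lam 0) * (\<phi> $ z)\<^sup>2" if z: "z < n" for z
  proof -
    define g :: "nat \<Rightarrow> real" where "g u = of_bool (u = z)" for u
    define f where "f u = \<phi> $ u * g u" for u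
    have dot_f: "dot n x f = x z * \<phi> $ z" for x
      using z by (simp add: dot_def f_def g_def if_distrib[of "\<lambda>y. _ * y"] of_bool_def cong: if_cong)
    have f_dot: "dot n f x = \<phi> $ z * x z" for x
      by (simp add: dot_commute[of n f x] dot_f)
    have Rzz: "?R z z = 0" by (simp add: routed_weight_def pos_edges_iff[of z z, simplified] w_diag)
    have "(\<Sum>x\<in>?V2. ?R (fst x) (snd x) * (g (fst x) - g (snd x))\<^sup>2) =
        (\<Sum>u<n. \<Sum>v<n. ?R u v * (g u - g v)\<^sup>2)"
      by (simp add: sum.cartesian_product split_def)
    also have "\<dots> = (\<Sum>u<n. \<Sum>v<n. ?R u v * g u + ?R u v * g v)"
      using Rzz by (intro sum.cong refl) (auto simp: g_def of_bool_def)
    also have "\<dots> = (\<Sum>u<n. \<Sum>v<n. ?R u v * g u) + (\<Sum>u<n. \<Sum>v<n. ?R u v * g v)"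
      by (simp add: sum.distrib)
    also have "(\<Sum>u<n. \<Sum>v<n. ?R u v * g v) = (\<Sum>u<n. \<Sum>v<n. ?R u v * g u)"
      by (subst sum.swap) (simp add: routed_weight_sym)
    also have "(\<Sum>u<n. \<Sum>v<n. ?R u v * g u) = (\<Sum>u<n. (\<Sum>v<n. ?R u v) * g u)"
      by (simp add: sum_distrib_right)
    also have "\<dots> = (\<Sum>u<n. if u = z then (\<Sum>v<n. ?R z v) else 0)"
      by (intro sum.cong) (auto simp: g_def)
    also have "\<dots> = (\<Sum>v<n. ?R z v)" using z by simp
    finally have "(\<Sum>v<n. ?R z v) = (\<Sum>x\<in>?V2. ?R (fst x) (snd x) * (g (fst x) - g (snd x))\<^sup>2) / 2"
      by simp
    also have "\<dots> \<le> dot n f (\<lambda>u. dot n (?M u) f) - lam 0 * dot n f f"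
      by (rule energy_le) (simp add: f_def)
    also have "\<dots> = (?M z z - lam 0) * (\<phi> $ z)\<^sup>2"
      unfolding f_dot dot_f by (simp add: f_def g_def power2_eq_square algebra_simps)
    also have "\<dots> \<le> (lam (n - 1) - lam 0) * (\<phi> $ z)\<^sup>2"
    proof (rule mult_right_mono)
      have "?M z z \<le> lam (n - 1)"
        using n by (intro diagonal_entry_le_max_eigenvalue[OF H sym cp _ z] mono) auto
      then show "?M z z - lam 0 \<le> lam (n - 1) - lam 0" by simp
    qed simp
    finally show ?thesis .
  qed
  interpret C: half_volume_isoperimetry "{..<n}" ?R "\<lambda>u. (\<phi> $ u)\<^sup>2" "h_routing n E w \<phi> \<alpha>" "lam (n - 1) - lam 0"
  proof
    show "0 < (\<phi> $ u)\<^sup>2" if "u \<in> {..<n}" for u using pos[of u] that by simp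
  qed (use adm pos n degree in \<open>auto intro: routed_weight_sym routed_weight_nonneg h_routing_nonneg
      h_routing_isoperimetry\<close>)
  obtain f where f: "dot n f (\<lambda>v. \<phi> $ v) = 0" "dot n f f > 0"
    "dot n f (\<lambda>i. dot n (?M i) f) \<le> lam 1 * dot n f f"
    by (rule test_vector_orthogonal_to_given[OF n H sym cp, of "\<lambda>v. \<phi> $ v"]) (use mono[of 0 1] n in auto)
  define g where "g u = f u / \<phi> $ u" for u
  have fg: "f u = \<phi> $ u * g u" if "u < n" for u using pos[OF that] by (simp add: g_def)
  have mass: "C.mass g = dot n f f"
    unfolding C.mass_def dot_def by (intro sum.cong) (auto simp: fg power2_eq_square)
  show ?thesis
  proof (rule C.cheeger)
    show "{..<n} \<noteq> {}" using n by (simp add: lessThan_empty_iff)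
    show "(\<Sum>u<n. (\<phi> $ u)\<^sup>2 * g u) = 0"
      using f(1) unfolding dot_def by (simp add: fg power2_eq_square algebra_simps)
    show "C.mass g > 0" using f(2) by (simp add: mass)
    have "C.energy g = (\<Sum>z\<in>?V2. ?R (fst z) (snd z) * (g (fst z) - g (snd z))\<^sup>2) / 2"
      by (simp add: C.energy_def sum.cartesian_product split_def)
    also have "\<dots> \<le> dot n f (\<lambda>u. dot n (?M u) f) - lam 0 * dot n f f"
      by (rule energy_le) (rule fg)
    also have "\<dots> \<le> (lam 1 - lam 0) * dot n f f"
      using f(3) by (simp add: left_diff_distrib)
    finally show "C.energy g \<le> (lam 1 - lam 0) * C.mass g" by (simp add: mass)
    show "lam 1 - lam 0 \<le> lam (n - 1) - lam 0" using mono[of 1 "n - 1"] n by simp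
  qed
qed

end

text \<open>The hypothesis says that \<open>(\<rho> - \<mu>)\<^sup>2 \<le> \<rho>\<^sup>2 - h\<^sup>2\<close>. It persists when \<open>\<rho>\<close> is increased to \<open>d + \<rho>\<close>,
  because \<open>\<mu> (2 \<rho> - \<mu>)\<close> grows with \<open>\<rho>\<close>.\<close>

lemma gap_bound_from_square:
  fixes \<mu> \<rho> d h :: real
  assumes "h\<^sup>2 \<le> \<mu> * (2 * \<rho> - \<mu>)" and "0 \<le> \<mu>" and "0 \<le> d"
  shows "(d + \<rho>) - sqrt ((d + \<rho>)\<^sup>2 - h\<^sup>2) \<le> \<mu>"
proof -
  have "0 \<le> 2 * d * \<mu>" using assms by simp
  then have "(d + \<rho> - \<mu>)\<^sup>2 \<le> (d + \<rho>)\<^sup>2 - h\<^sup>2"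
    using assms(1) by (simp add: power2_eq_square algebra_simps)
  then have "d + \<rho> - \<mu> \<le> sqrt ((d + \<rho>)\<^sup>2 - h\<^sup>2)" by (rule real_le_rsqrt)
  then show ?thesis by simp
qed

theorem corollary4:
  fixes n :: nat and E :: "nat set set" and w :: "nat \<Rightarrow> nat \<Rightarrow> real"
    and H W :: "real mat" and \<phi> :: "real vec" and lam :: "nat \<Rightarrow> real" and d_max :: real
  assumes "n \<ge> 2"
    and "weighted_graph n E w"
    and "W \<in> carrier_mat n n" and "diagonal_mat W"
    and "H = laplacian n w + W"
    and "sorted_eigenvalues n H lam"
    and "eigenvector H \<phi> (lam 0)" and "\<forall>u<n. \<phi> $ u \<ge> 0"
    and "connected_graph n (pos_edges E w)"
    and "\<exists>\<alpha>. admissible n E w \<phi> \<alpha>"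
    and "\<forall>u<n. pos_degree n E w u \<le> d_max"
  shows "let \<rho> = lam (n - 1) - lam 0; h = h_sup n E w \<phi>
         in lam 1 - lam 0 \<ge> (d_max + \<rho>) - sqrt ((d_max + \<rho>)\<^sup>2 - h\<^sup>2)"
proof -
  interpret signed_graph n E w by unfold_locales (rule assms(2))
  define \<mu> where "\<mu> = lam 1 - lam 0"
  define \<rho> where "\<rho> = lam (n - 1) - lam 0"
  have H: "H \<in> carrier_mat n n" using assms(3,5) by (simp add: laplacian_def)
  have off: "H $$ (u, v) = - w u v" if "u < n" "v < n" "u \<noteq> v" for u v
    using that assms(3,4,5) by (simp add: laplacian_def diagonal_mat_def)
  have ev: "dot n (\<lambda>v. H $$ (u, v)) (\<lambda>v. \<phi> $ v) = lam 0 * \<phi> $ u" if u: "u < n" for u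
  proof -
    have \<phi>: "\<phi> \<in> carrier_vec n" "H *\<^sub>v \<phi> = lam 0 \<cdot>\<^sub>v \<phi>"
      using assms(7) H by (auto simp: eigenvector_def)
    have "dot n (\<lambda>v. H $$ (u, v)) (\<lambda>v. \<phi> $ v) = (H *\<^sub>v \<phi>) $ u"
      using u H \<phi>(1) by (auto simp: dot_def scalar_prod_def lessThan_atLeast0)
    then show ?thesis using u \<phi> by simp
  qed
  have pos: "\<phi> $ u > 0" if "u < n" for u
    using ground_state_pos[OF assms(1,9)] assms(8,10) that by blast
  have bound: "(h_routing n E w \<phi> \<alpha>)\<^sup>2 \<le> \<mu> * (2 * \<rho> - \<mu>)" if "admissible n E w \<phi> \<alpha>" for \<alpha>
    unfolding \<mu>_def \<rho>_def using that by (intro routing_cheeger[OF assms(1) H off assms(6) ev pos])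
  \<comment> \<open>A bound on \<open>h\<^sub>\<alpha>\<close> that is uniform in \<open>\<alpha>\<close>, so that it passes to the supremum.\<close>
  define K where "K = sqrt (\<mu> * (2 * \<rho> - \<mu>))"
  have le_K: "h_routing n E w \<phi> \<alpha> \<le> K" if "admissible n E w \<phi> \<alpha>" for \<alpha>
    unfolding K_def using bound[OF that] by (rule real_le_rsqrt)
  obtain \<alpha> where \<alpha>: "admissible n E w \<phi> \<alpha>" using assms(10) by blast
  have "0 \<le> h_routing n E w \<phi> \<alpha>" using assms(1) \<alpha> by (rule h_routing_nonneg)
  also have "\<dots> \<le> h_sup n E w \<phi>"
    unfolding h_sup_def using \<alpha> le_K by (intro cSUP_upper bdd_aboveI2) auto
  finally have h0: "0 \<le> h_sup n E w \<phi>" .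
  have "h_sup n E w \<phi> \<le> K"
    unfolding h_sup_def using \<alpha> le_K by (intro cSUP_least) auto
  then have "(h_sup n E w \<phi>)\<^sup>2 \<le> K\<^sup>2" using h0 by (rule power_mono)
  also have "K\<^sup>2 = \<mu> * (2 * \<rho> - \<mu>)"
    unfolding K_def using order.trans[OF zero_le_power2 bound[OF \<alpha>]] by (rule real_sqrt_pow2)
  finally have "(h_sup n E w \<phi>)\<^sup>2 \<le> \<mu> * (2 * \<rho> - \<mu>)" .
  moreover have "0 \<le> \<mu>" using assms(1,6) by (simp add: \<mu>_def sorted_eigenvalues_def)
  moreover have "0 \<le> d_max"
    using order.trans[OF pos_degree_nonneg[of 0]] assms(1,11) by simp
  ultimately show ?thesis
    unfolding Let_def \<mu>_def[symmetric] \<rho>_def[symmetric] by (rule gap_bound_from_square)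
qed

end
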